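(* Let $X(t)$, $a\le t\le b$, be a Yeh process associated with functions $\lambda$ and $\rho$ on $[a,b]$, and suppose that the mean function $\lambda$ is increasing on $[a,b]$. Let $f\in L^2_{\lambda,\rho}[a,b]$ be a nonnegative function. Then the stochastic process $$M(t)=\int_a^t f(s)\,dX(s),\qquad a\le t\le b,$$ is a submartingale with respect to the filtration $\{\mathcal F_t: a\le t\le b\}$ defined by $\mathcal F_t=\sigma\{X(s): a\le s\le t\}$.
   Context: Fix a finite interval $[a,b]\subset[0,\infty)$. Standing assumptions: $\lambda$ is a continuous real-valued function of bounded variation on $[a,b]$, with total variation function $|\lambda|$; $\rho$ is a continuous monotonically increasing real-valued function on $[a,b]$ whose Lebesgue-Stieltjes measure is equivalent (mutually absolutely continuous) to Lebesgue measure on $[a,b]$. A Yeh process associated with $\lambda,\rho$ is a real-valued stochastic process $X(t)$, $t\in[a,b]$, on a probability space $\Omega$, with (almost surely) continuous sample paths, which is additive, i.e. for all $a=t_0<t_1<\dots<t_n\le b$ the random variables $X(t_0),X(t_1)-X(t_0),\dots,X(t_n)-X(t_{n-1})$ are independent, and such that for all $a\le s<t\le b$, $X(t)-X(s)\sim N(\lambda(t)-\lambda(s),\rho(t)-\rho(s))$, where $N(\mu,\sigma^2)$ is the normal distribution with mean $\mu$ and variance $\sigma^2$. $L^2_{\lambda,\rho}[a,b]$ is the Hilbert space of real functions $f$ on $[a,b]$ with $\int_a^b|f|^2\,d\rho<\infty$ and $\int_a^b|f|^2\,d|\lambda|<\infty$, with inner product $\langle f,g\rangle_{\lambda,\rho}=\int_a^b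 fg\,d[\rho+|\lambda|]$. Wiener integral: for a step function $f=\sum_{i=1}^n c_i1_{[t_{i-1},t_i)}$ with $a=t_0<\dots<t_n=b$ and $c_i\in\mathbb R$, set $I(f)=\sum_{i=1}^n c_i(X(t_i)-X(t_{i-1}))$. Step functions are dense in $L^2_{\lambda,\rho}[a,b]$; for $f\in L^2_{\lambda,\rho}[a,b]$, $I(f)=\int_a^b f(t)\,dX(t)$ is defined as the $L^2(\Omega)$-limit of $I(f_n)$ for any sequence of step functions $f_n$ converging to $f$ in $L^2_{\lambda,\rho}[a,b]$ (the limit exists and does not depend on the sequence). For $a\le t\le b$, $\int_a^t f\,dX:=I(f1_{[a,t)})$. Wiener integrals are defined only up to almost sure equality, and adaptedness of $M$ is understood in that sense: $M(t)$ is almost surely equal to an $\mathcal F_t$-measurable random variable. Submartingale means: adapted, $E|M(t)|<\infty$ for all $t$, and $E[M(t)\mid\mathcal F_s]\ge M(s)$ almost surely for all $a\le s\le t\le b$. *)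

theory Defs
  imports "HOL-Probability.Probability"
begin

section \<open>Partitions and total variation\<close>

text \<open>A partition with \<open>n = 0\<close> subintervals exists only when \<open>u = v\<close>.\<close>

definition is_partition :: "real \<Rightarrow> real \<Rightarrow> nat \<Rightarrow> (nat \<Rightarrow> real) \<Rightarrow> bool" where
  "is_partition u v n t \<longleftrightarrow> t 0 = u \<and> t n = v \<and> (\<forall>i<n. t i < t (Suc i))"

definition variation_sums :: "(real \<Rightarrow> real) \<Rightarrow> real \<Rightarrow> real \<Rightarrow> real set" where
  "variation_sums g u v = {(\<Sum>i<n. \<bar>g (t (Suc i)) - g (t i)\<bar>) | n t. is_partition u v n t}"

definition bounded_variation_on :: "real \<Rightarrow> real \<Rightarrow> (real \<Rightarrow> real) \<Rightarrow> bool" where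
  "bounded_variation_on a b g \<longleftrightarrow> bdd_above (variation_sums g a b)"

definition total_variation :: "real \<Rightarrow> (real \<Rightarrow> real) \<Rightarrow> real \<Rightarrow> real" where
  "total_variation a g x = Sup (variation_sums g a x)"


section \<open>Lebesgue--Stieltjes measures on a compact interval\<close>

text \<open>The library constructs the Borel measure of a nondecreasing right-continuous function on the
  whole line, so \<open>F\<close> is extended from \<open>[a, b]\<close> to the line by constants. The measure is completed,
  as Lebesgue--Stieltjes measures are, and then restricted to the space \<open>[a, b]\<close>; in particular,
  measurability with respect to it only concerns the values of a function on \<open>[a, b]\<close>.\<close>

definition stieltjes_on :: "real \<Rightarrow> real \<Rightarrow> (real \<Rightarrow> real) \<Rightarrow> real measure" where
  "stieltjes_on a b F =
     restrict_space (completion (interval_measure (\<lambda>x. F (max a (min b x))))) {a..b}"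

definition yeh_parameters :: "real \<Rightarrow> real \<Rightarrow> (real \<Rightarrow> real) \<Rightarrow> (real \<Rightarrow> real) \<Rightarrow> bool" where
  "yeh_parameters a b lam \<rho> \<longleftrightarrow>
     continuous_on {a..b} lam \<and> bounded_variation_on a b lam \<and>
     continuous_on {a..b} \<rho> \<and> mono_on {a..b} \<rho> \<and>
     absolutely_continuous (stieltjes_on a b \<rho>) (lebesgue_on {a..b}) \<and>
     absolutely_continuous (lebesgue_on {a..b}) (stieltjes_on a b \<rho>)"


section \<open>Yeh processes\<close>

definition additive_process ::
    "'w measure \<Rightarrow> real \<Rightarrow> real \<Rightarrow> (real \<Rightarrow> 'w \<Rightarrow> real) \<Rightarrow> bool" where
  "additive_process P a b X \<longleftrightarrow>
     (\<forall>n t. is_partition a (t n) n t \<and> t n \<le> b \<longrightarrow>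
        prob_space.indep_vars P (\<lambda>_. borel)
          (\<lambda>i. if i = 0 then X (t 0) else (\<lambda>\<omega>. X (t i) \<omega> - X (t (i - 1)) \<omega>)) {..n})"

text \<open>The second parameter of \<^const>\<open>normal_density\<close> is the standard deviation. The variances
  \<open>\<rho> t - \<rho> s\<close> are positive for \<open>s < t\<close>, because the measure of \<open>\<rho>\<close> is equivalent to
  Lebesgue measure, so the normal laws do have densities.\<close>

definition yeh_process ::
    "'w measure \<Rightarrow> real \<Rightarrow> real \<Rightarrow> (real \<Rightarrow> real) \<Rightarrow> (real \<Rightarrow> real) \<Rightarrow> (real \<Rightarrow> 'w \<Rightarrow> real) \<Rightarrow> bool" where
  "yeh_process P a b lam \<rho> X \<longleftrightarrow>
     prob_space P \<and>
     (\<forall>t\<in>{a..b}. X t \<in> borel_measurable P) \<and>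
     (AE \<omega> in P. continuous_on {a..b} (\<lambda>t. X t \<omega>)) \<and>
     additive_process P a b X \<and>
     (\<forall>s t. a \<le> s \<and> s < t \<and> t \<le> b \<longrightarrow>
        distributed P lborel (\<lambda>\<omega>. X t \<omega> - X s \<omega>)
          (normal_density (lam t - lam s) (sqrt (\<rho> t - \<rho> s))))"


section \<open>The space \<open>L\<^sup>2\<close> of \<open>\<lambda>\<close>, \<open>\<rho>\<close> and the Wiener integral\<close>

definition L2_space ::
    "real \<Rightarrow> real \<Rightarrow> (real \<Rightarrow> real) \<Rightarrow> (real \<Rightarrow> real) \<Rightarrow> (real \<Rightarrow> real) set" where
  "L2_space a b lam \<rho> =
     {f. f \<in> borel_measurable (stieltjes_on a b \<rho>) \<and>
         f \<in> borel_measurable (stieltjes_on a b (total_variation a lam)) \<and>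
         integrable (stieltjes_on a b \<rho>) (\<lambda>s. \<bar>f s\<bar>\<^sup>2) \<and>
         integrable (stieltjes_on a b (total_variation a lam)) (\<lambda>s. \<bar>f s\<bar>\<^sup>2)}"

definition L2_inner ::
    "real \<Rightarrow> real \<Rightarrow> (real \<Rightarrow> real) \<Rightarrow> (real \<Rightarrow> real) \<Rightarrow> (real \<Rightarrow> real) \<Rightarrow> (real \<Rightarrow> real) \<Rightarrow> real" where
  "L2_inner a b lam \<rho> f g =
     (LINT s|stieltjes_on a b (\<lambda>u. \<rho> u + total_variation a lam u). f s * g s)"

definition L2_dist ::
    "real \<Rightarrow> real \<Rightarrow> (real \<Rightarrow> real) \<Rightarrow> (real \<Rightarrow> real) \<Rightarrow> (real \<Rightarrow> real) \<Rightarrow> (real \<Rightarrow> real) \<Rightarrow> real" where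
  "L2_dist a b lam \<rho> f g =
     sqrt (L2_inner a b lam \<rho> (\<lambda>s. f s - g s) (\<lambda>s. f s - g s))"

definition step_fun :: "nat \<Rightarrow> (nat \<Rightarrow> real) \<Rightarrow> (nat \<Rightarrow> real) \<Rightarrow> real \<Rightarrow> real" where
  "step_fun n t c s = (\<Sum>i<n. c i * indicator {t i..<t (Suc i)} s)"

definition step_integral ::
    "(real \<Rightarrow> 'w \<Rightarrow> real) \<Rightarrow> nat \<Rightarrow> (nat \<Rightarrow> real) \<Rightarrow> (nat \<Rightarrow> real) \<Rightarrow> 'w \<Rightarrow> real" where
  "step_integral X n t c \<omega> = (\<Sum>i<n. c i * (X (t (Suc i)) \<omega> - X (t i) \<omega>))"

text \<open>\<open>has_wiener_integral P X a b lam \<rho> f Y\<close>: the random variable \<open>Y\<close> is a version of the Wiener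
  integral of \<open>f\<close> with respect to \<open>X\<close>, that is, the \<open>L\<^sup>2\<close>-limit of the integrals of step functions
  converging to \<open>f\<close>. For \<open>f\<close> in \<open>L2_space\<close> the limit exists, is unique almost surely and does not
  depend on the approximating sequence, so it suffices to ask for one sequence. The Wiener
  integral is a relation and not a function, since it is determined only up to almost sure
  equality.\<close>

definition has_wiener_integral ::
    "'w measure \<Rightarrow> (real \<Rightarrow> 'w \<Rightarrow> real) \<Rightarrow> real \<Rightarrow> real \<Rightarrow> (real \<Rightarrow> real) \<Rightarrow> (real \<Rightarrow> real) \<Rightarrow>
     (real \<Rightarrow> real) \<Rightarrow> ('w \<Rightarrow> real) \<Rightarrow> bool" where
  "has_wiener_integral P X a b lam \<rho> f Y \<longleftrightarrow>
     Y \<in> borel_measurable P \<and> integrable P (\<lambda>\<omega>. (Y \<omega>)\<^sup>2) \<and>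
     (\<exists>n t c.
        (\<forall>k. is_partition a b (n k) (t k)) \<and>
        (\<lambda>k. L2_dist a b lam \<rho> (step_fun (n k) (t k) (c k)) f) \<longlonglongrightarrow> 0 \<and>
        (\<lambda>k. LINT \<omega>|P. (step_integral X (n k) (t k) (c k) \<omega> - Y \<omega>)\<^sup>2) \<longlonglongrightarrow> 0)"

definition has_wiener_integral_upto ::
    "'w measure \<Rightarrow> (real \<Rightarrow> 'w \<Rightarrow> real) \<Rightarrow> real \<Rightarrow> real \<Rightarrow> (real \<Rightarrow> real) \<Rightarrow> (real \<Rightarrow> real) \<Rightarrow>
     (real \<Rightarrow> real) \<Rightarrow> real \<Rightarrow> ('w \<Rightarrow> real) \<Rightarrow> bool" where
  "has_wiener_integral_upto P X a b lam \<rho> f t Y \<longleftrightarrow>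
     has_wiener_integral P X a b lam \<rho> (\<lambda>s. f s * indicator {a..<t} s) Y"


section \<open>Submartingales\<close>

definition natural_filtration ::
    "'w measure \<Rightarrow> real \<Rightarrow> (real \<Rightarrow> 'w \<Rightarrow> real) \<Rightarrow> real \<Rightarrow> 'w measure" where
  "natural_filtration P a X t =
     sigma (space P) {X s -` A \<inter> space P | s A. s \<in> {a..t} \<and> A \<in> sets borel}"

text \<open>Adaptedness is understood up to almost sure equality. The \<^const>\<open>subalgebra\<close> condition is
  needed for \<^const>\<open>real_cond_exp\<close> to be meaningful.\<close>

definition submartingale_on ::
    "'w measure \<Rightarrow> real \<Rightarrow> real \<Rightarrow> (real \<Rightarrow> 'w measure) \<Rightarrow> (real \<Rightarrow> 'w \<Rightarrow> real) \<Rightarrow> bool" where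
  "submartingale_on P a b F M \<longleftrightarrow>
     (\<forall>t\<in>{a..b}. subalgebra P (F t)) \<and>
     (\<forall>s\<in>{a..b}. \<forall>t\<in>{a..b}. s \<le> t \<longrightarrow> sets (F s) \<subseteq> sets (F t)) \<and>
     (\<forall>t\<in>{a..b}. \<exists>Z \<in> borel_measurable (F t). AE \<omega> in P. M t \<omega> = Z \<omega>) \<and>
     (\<forall>t\<in>{a..b}. integrable P (M t)) \<and>
     (\<forall>s\<in>{a..b}. \<forall>t\<in>{a..b}. s \<le> t \<longrightarrow> (AE \<omega> in P. M s \<omega> \<le> real_cond_exp P (F s) (M t) \<omega>))"

end

theory Submission
  imports Defs
begin

text \<open>
  For \<open>s \<le> t\<close> the process satisfies \<open>E[M t | \<F> s] = M s + c\<close> almost surely with a constant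
  \<open>c \<ge> 0\<close>; informally \<open>c\<close> is the integral of \<open>f\<close> over \<open>[s, t)\<close> with respect to \<open>\<lambda>\<close>, which is nonnegative
  because \<open>f \<ge> 0\<close> and \<open>\<lambda>\<close> increases.

  For a step function the identity is immediate. Its integral splits at \<open>s\<close> into a part built from
  increments before \<open>s\<close>, which is measurable at time \<open>s\<close>, and a part built from increments after \<open>s\<close>.
  These are independent of the past (\<open>indep_past_increment\<close>), so conditioning replaces the
  second part by its mean, the integral of the step function over \<open>[s, b)\<close> with respect to \<open>\<lambda>\<close>.

  The passage to the limit rests on the isometry \<open>elementary_integral_inner\<close>: the second moment of the
  integral of a step function \<open>g\<close> is \<open>\<integral>g\<^sup>2 d\<rho> + (\<integral>g d\<lambda>)\<^sup>2\<close>, which is at most a constant times the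
  squared norm of \<open>g\<close> in the \<open>L\<^sup>2\<close> space of \<open>\<rho> + \<bar>\<lambda>\<bar>\<close>. Therefore the limit does not depend on the
  approximating sequence (\<open>elementary_integral_tendsto\<close>), and the restrictions to \<open>[a, s)\<close> of a
  sequence that approximates the integrand of \<open>M t\<close> approximate \<open>M s\<close>. Adaptedness follows, since an
  \<open>L\<^sup>2\<close>-limit of functions measurable at time \<open>s\<close> has a version with this property
  (\<open>L2_limit_measurable_version\<close>). The means of the second parts converge to some \<open>c\<close>, which is
  nonnegative although the approximating step functions may be negative in places, because
  their negative parts tend to \<open>0\<close> (\<open>integral_mu_lam_limit_nonneg\<close>).

  On the analytic side, the norm is formed with the completed Stieltjes measure of \<open>\<rho> + \<bar>\<lambda>\<bar>\<close>, whereas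
  membership in \<open>L2_space\<close> is a condition on the measures of \<open>\<rho>\<close> and \<open>\<bar>\<lambda>\<bar>\<close> separately; the two are
  related by the additivity of Stieltjes measures in their distribution functions. As \<open>\<lambda>\<close> increases, \<open>\<bar>\<lambda>\<bar>\<close>
  is \<open>\<lambda>\<close> up to a constant.
\<close>

section \<open>Sums of Stieltjes measures\<close>

lemma nn_integral_measure_sum:
  assumes sets1: "sets M1 = sets M" and sets2: "sets M2 = sets M"
    and sum: "\<And>A. A \<in> sets M \<Longrightarrow> emeasure M A = emeasure M1 A + emeasure M2 A"
    and h: "h \<in> borel_measurable M"
  shows "(\<integral>\<^sup>+x. h x \<partial>M) = (\<integral>\<^sup>+x. h x \<partial>M1) + (\<integral>\<^sup>+x. h x \<partial>M2)"
proof -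
  note [measurable_cong] = sets1 sets2
  have sp: "space M1 = space M" "space M2 = space M"
    using sets1 sets2 by (auto dest: sets_eq_imp_space_eq)
  show ?thesis
    using h
  proof (induction rule: borel_measurable_induct)
    case (cong f g)
    then show ?case
      using nn_integral_cong[of M f g] nn_integral_cong[of M1 f g] nn_integral_cong[of M2 f g] sp by simp
  next
    case (set A)
    then show ?case by (simp add: sum sets1 sets2)
  next
    case (mult u c)
    then show ?case by (simp add: nn_integral_cmult distrib_left)
  next
    case (add u v)
    then show ?case by (simp add: nn_integral_add algebra_simps)
  next
    case (seq U)
    have eq: "(\<integral>\<^sup>+x. (SUP i. U i) x \<partial>N) = (SUP i. \<integral>\<^sup>+x. U i x \<partial>N)" if "sets N = sets M" for N
      using nn_integral_monotone_convergence_SUP[of U N] seq that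
      by (simp add: image_comp measurable_cong_sets[OF that refl])
    have "incseq (\<lambda>i. \<integral>\<^sup>+x. U i x \<partial>N)" for N
      using \<open>incseq U\<close> by (auto simp: incseq_def le_fun_def intro!: nn_integral_mono)
    then show ?case
      unfolding eq[OF refl] eq[OF sets1] eq[OF sets2] seq.IH by (simp only: ennreal_SUP_add)
  qed
qed

lemma null_sets_measure_sum:
  assumes "sets M1 = sets M" and "sets M2 = sets M"
    and "\<And>A. A \<in> sets M \<Longrightarrow> emeasure M A = emeasure M1 A + emeasure M2 A"
  shows "null_sets M = null_sets M1 \<inter> null_sets M2"
  using assms by (auto simp: null_sets_def)

text \<open>A null set of the sum is a null set of both summands. If a set agrees with a measurable \<open>S1\<close> up
  to a null set \<open>K1\<close> of the first measure, and with \<open>S2\<close> up to a null set \<open>K2\<close> of the second, then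
  it differs from \<open>S1 \<union> S2\<close> only inside \<open>K1 \<inter> K2\<close>, which is null for both.\<close>

lemma sets_completion_sum:
  assumes sets1: "sets M1 = sets M" and sets2: "sets M2 = sets M"
    and sum: "\<And>A. A \<in> sets M \<Longrightarrow> emeasure M A = emeasure M1 A + emeasure M2 A"
    and A1: "A \<in> sets (completion M1)" and A2: "A \<in> sets (completion M2)"
  shows "A \<in> sets (completion M)"
proof -
  obtain S1 N1 K1 where 1: "A = S1 \<union> N1" "N1 \<subseteq> K1" "K1 \<in> null_sets M1" "S1 \<in> sets M1"
    using A1 by (rule sets_completionE)
  obtain S2 N2 K2 where 2: "A = S2 \<union> N2" "N2 \<subseteq> K2" "K2 \<in> null_sets M2" "S2 \<in> sets M2"
    using A2 by (rule sets_completionE)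
  have "K1 \<in> sets M2" "K2 \<in> sets M1"
    using 1 2 sets1 sets2 by auto
  then have "K1 \<inter> K2 \<in> null_sets M1" "K1 \<inter> K2 \<in> null_sets M2"
    using 1 2 by (auto intro: null_set_Int1 null_set_Int2)
  then have K: "K1 \<inter> K2 \<in> null_sets M"
    using null_sets_measure_sum[OF assms(1-3)] by simp
  have "A = (S1 \<union> S2) \<union> (A - (S1 \<union> S2))" using 1 2 by auto
  moreover have "A - (S1 \<union> S2) \<subseteq> K1 \<inter> K2" using 1 2 by auto
  moreover have "S1 \<union> S2 \<in> sets M" using 1 2 sets1 sets2 by auto
  ultimately show ?thesis using K sets_completionI by metis
qed

text \<open>Measurability for the completion of the sum provides one Borel representative that is valid
  almost everywhere for both summands, so the completed case reduces to the uncompleted one.\<close>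

lemma nn_integral_completion_sum:
  assumes sets1: "sets M1 = sets M" and sets2: "sets M2 = sets M"
    and sum: "\<And>A. A \<in> sets M \<Longrightarrow> emeasure M A = emeasure M1 A + emeasure M2 A"
    and h: "h \<in> borel_measurable (completion M)"
  shows "(\<integral>\<^sup>+x. h x \<partial>completion M) = (\<integral>\<^sup>+x. h x \<partial>completion M1) + (\<integral>\<^sup>+x. h x \<partial>completion M2)"
proof -
  obtain g where g: "g \<in> borel_measurable M" and eq: "AE x in M. h x = g x"
    using completion_ex_borel_measurable[OF h] by auto
  obtain N where N: "N \<in> null_sets M" "{x\<in>space M. h x \<noteq> g x} \<subseteq> N"
    using eq by (auto elim!: AE_E)
  have sp: "space M1 = space M" "space M2 = space M"
    using sets1 sets2 by (auto dest: sets_eq_imp_space_eq)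
  have "AE x in M1. h x = g x" "AE x in M2. h x = g x"
    using N sp null_sets_measure_sum[OF assms(1-3)] by (auto intro!: AE_I'[of N])
  with eq show ?thesis
    using nn_integral_measure_sum[OF assms(1-3) g]
    by (simp add: nn_integral_completion cong: nn_integral_cong_AE)
qed

text \<open>The two sides are measures that agree on the half-open intervals, an intersection-stable
  generator of the Borel sets.\<close>

lemma emeasure_interval_measure_sum:
  fixes F G :: "real \<Rightarrow> real"
  assumes F: "\<And>x y. x \<le> y \<Longrightarrow> F x \<le> F y" "\<And>x. continuous (at_right x) F"
    and G: "\<And>x y. x \<le> y \<Longrightarrow> G x \<le> G y" "\<And>x. continuous (at_right x) G"
    and A: "A \<in> sets borel"
  shows "emeasure (interval_measure (\<lambda>x. F x + G x)) A
       = emeasure (interval_measure F) A + emeasure (interval_measure G) A"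
proof -
  let ?\<mu> = "\<lambda>A. emeasure (interval_measure F) A + emeasure (interval_measure G) A"
  define N where "N = measure_of UNIV (sets borel) ?\<mu>"
  have sets_N: "sets N = sets borel"
    unfolding N_def by (metis sets.sets_measure_of_eq space_borel)
  have emeasure_N: "emeasure N B = ?\<mu> B" if "B \<in> sets borel" for B
  proof (rule emeasure_measure_of[OF N_def])
    show "countably_additive (sets N) ?\<mu>"
      by (auto simp: countably_additive_def sets_N suminf_add[symmetric] suminf_emeasure)
  qed (auto simp: positive_def sets_N that)
  have FG: "\<And>x y. x \<le> y \<Longrightarrow> F x + G x \<le> F y + G y" "\<And>x. continuous (at_right x) (\<lambda>x. F x + G x)"
    using F G by (auto intro!: add_mono continuous_intros)
  let ?E = "range (\<lambda>(c, d). {c<..d::real})"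
  have Int: "Int_stable ?E"
    by (fastforce simp: Int_stable_def)
  have "interval_measure (\<lambda>x. F x + G x) = N"
  proof (rule measure_eqI_generator_eq[OF Int, where \<Omega> = UNIV and A = "\<lambda>n::nat. {- real n<..real n}"])
    show "emeasure (interval_measure (\<lambda>x. F x + G x)) X = emeasure N X" if "X \<in> ?E" for X
    proof -
      from that obtain c d where X: "X = {c<..d}" by auto
      show ?thesis
        using F(1)[of c d] G(1)[of c d]
        by (simp add: X emeasure_N emeasure_interval_measure_Ioc_eq F G FG add_mono
             flip: ennreal_plus)
    qed
    show "sets (interval_measure (\<lambda>x. F x + G x)) = sigma_sets UNIV ?E"
      by (simp add: borel_sigma_sets_Ioc)
    show "sets N = sigma_sets UNIV ?E"
      by (simp add: sets_N borel_sigma_sets_Ioc)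
    show "(\<Union>n::nat. {- real n<..real n}) = UNIV"
    proof (rule UNIV_eq_I[symmetric])
      fix x :: real
      obtain n :: nat where "\<bar>x\<bar> < real n" using reals_Archimedean2 by blast
      then show "x \<in> (\<Union>n::nat. {- real n<..real n})" by (intro UN_I[of n]) auto
    qed
    show "emeasure (interval_measure (\<lambda>x. F x + G x)) {- real n<..real n} \<noteq> \<infinity>" for n :: nat
      by (simp add: emeasure_interval_measure_Ioc_eq FG)
  qed auto
  then show ?thesis using emeasure_N[OF A] by simp
qed

text \<open>The measure on \<open>[a, b]\<close> comes from the function extended by constants, \<open>x \<mapsto> F (max a (min b x))\<close>.
  The extension inherits monotonicity and continuity from \<open>F\<close>.\<close>

lemma clamp_mono:
  fixes F :: "real \<Rightarrow> real"
  assumes "a \<le> b" "mono_on {a..b} F" "x \<le> y"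
  shows "F (max a (min b x)) \<le> F (max a (min b y))"
  using assms by (intro mono_onD[OF assms(2)]) auto

lemma clamp_continuous:
  fixes F :: "real \<Rightarrow> real"
  assumes "a \<le> b" "continuous_on {a..b} F"
  shows "continuous_on A (\<lambda>x. F (max a (min b x)))"
  using assms by (intro continuous_on_compose2[OF assms(2)] continuous_intros) auto

lemma clamp_continuous_right:
  fixes F :: "real \<Rightarrow> real"
  assumes "a \<le> b" "continuous_on {a..b} F"
  shows "continuous (at_right x) (\<lambda>x. F (max a (min b x)))"
  using clamp_continuous[OF assms, of UNIV]
  by (auto simp: continuous_on_eq_continuous_at intro: continuous_at_imp_continuous_within)

lemma space_stieltjes_on [simp]: "space (stieltjes_on a b F) = {a..b}"
  by (simp add: stieltjes_on_def)

lemma borel_measurable_stieltjes_on: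
  assumes "g \<in> borel_measurable borel"
  shows "g \<in> borel_measurable (stieltjes_on a b F)"
  unfolding stieltjes_on_def
  by (intro measurable_restrict_space1 measurable_completion)
     (use assms in \<open>simp cong: measurable_cong_sets\<close>)

lemma sets_stieltjes_on_borel:
  assumes "A \<in> sets borel" "A \<subseteq> {a..b}"
  shows "A \<in> sets (stieltjes_on a b F)"
  using assms unfolding stieltjes_on_def by (subst sets_restrict_space_iff) auto

lemma emeasure_stieltjes_on_borel:
  assumes "A \<in> sets borel" "A \<subseteq> {a..b}"
  shows "emeasure (stieltjes_on a b F) A = emeasure (interval_measure (\<lambda>x. F (max a (min b x)))) A"
  unfolding stieltjes_on_def
  using assms by (subst emeasure_restrict_space) (auto simp: emeasure_completion)

lemma emeasure_stieltjes_on_Icc: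
  assumes "a \<le> b" "mono_on {a..b} F" "continuous_on {a..b} F" and "a \<le> p" "p \<le> q" "q \<le> b"
  shows "emeasure (stieltjes_on a b F) {p..q} = ennreal (F q - F p)"
  using assms
  by (subst emeasure_stieltjes_on_borel)
     (auto simp: emeasure_interval_measure_Icc clamp_mono clamp_continuous)

lemma finite_measure_stieltjes_on:
  assumes "a \<le> b" "mono_on {a..b} F" "continuous_on {a..b} F"
  shows "finite_measure (stieltjes_on a b F)"
  using assms by (intro finite_measureI) (simp add: emeasure_stieltjes_on_Icc)

lemma measure_stieltjes_on_Icc:
  assumes "a \<le> b" "mono_on {a..b} F" "continuous_on {a..b} F" and "a \<le> p" "p \<le> q" "q \<le> b"
  shows "measure (stieltjes_on a b F) {p..q} = F q - F p"
  using emeasure_stieltjes_on_Icc[OF assms] mono_onD[OF assms(2), of p q] assms(4-6)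
  by (simp add: measure_def)

text \<open>Step functions are built from half-open intervals \<open>[p, q)\<close>, whereas Stieltjes measures are computed
  most directly on closed ones. Continuity of \<open>F\<close> makes the end point \<open>q\<close> negligible.\<close>

lemma measure_stieltjes_on_Ico:
  assumes F: "a \<le> b" "mono_on {a..b} F" "continuous_on {a..b} F" and pq: "a \<le> p" "p \<le> q" "q \<le> b"
  shows "measure (stieltjes_on a b F) {p..<q} = F q - F p"
proof -
  interpret finite_measure "stieltjes_on a b F" using finite_measure_stieltjes_on[OF F] .
  have "measure (stieltjes_on a b F) ({p..q} - {q}) = measure (stieltjes_on a b F) {p..q} - measure (stieltjes_on a b F) {q}"
    using pq by (intro finite_measure_Diff) (auto intro!: sets_stieltjes_on_borel)
  moreover have "{p..q} - {q} = {p..<q}" by auto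
  ultimately show ?thesis
    using measure_stieltjes_on_Icc[OF F pq] measure_stieltjes_on_Icc[OF F, of q q] pq by simp
qed

context
  fixes a b :: real and F G :: "real \<Rightarrow> real"
  assumes ab: "a \<le> b"
    and F: "mono_on {a..b} F" "continuous_on {a..b} F"
    and G: "mono_on {a..b} G" "continuous_on {a..b} G"
begin

lemma interval_measure_clamp_sum:
  assumes "A \<in> sets (interval_measure (\<lambda>x. F (max a (min b x)) + G (max a (min b x))))"
  shows "emeasure (interval_measure (\<lambda>x. F (max a (min b x)) + G (max a (min b x)))) A =
    emeasure (interval_measure (\<lambda>x. F (max a (min b x)))) A
    + emeasure (interval_measure (\<lambda>x. G (max a (min b x)))) A"
  using assms
  by (intro emeasure_interval_measure_sum clamp_mono clamp_continuous_right ab F G) simp_all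

text \<open>The completions of the two measures have different \<open>\<sigma>\<close>-algebras, so no single Borel representative
  is available at first; the argument goes through the preimages of Borel sets. This is what places a
  member of \<open>L2_space\<close> in the \<open>L\<^sup>2\<close> space of the sum, with respect to which \<open>L2_dist\<close> is formed.\<close>

lemma borel_measurable_stieltjes_on_sum:
  fixes h :: "real \<Rightarrow> real"
  assumes hF: "h \<in> borel_measurable (stieltjes_on a b F)" and hG: "h \<in> borel_measurable (stieltjes_on a b G)"
  shows "h \<in> borel_measurable (stieltjes_on a b (\<lambda>x. F x + G x))"
proof (rule measurableI)
  fix B :: "real set" assume "B \<in> sets borel"
  then have "h -` B \<inter> {a..b} \<in> sets (stieltjes_on a b F)" "h -` B \<inter> {a..b} \<in> sets (stieltjes_on a b G)"
    using measurable_sets[OF hF, of B] measurable_sets[OF hG, of B] by auto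
  then have "h -` B \<inter> {a..b} \<in> sets (completion (interval_measure (\<lambda>x. F (max a (min b x)) + G (max a (min b x)))))"
    by (intro sets_completion_sum[OF _ _ interval_measure_clamp_sum])
      (auto simp: stieltjes_on_def sets_restrict_space_iff)
  then show "h -` B \<inter> space (stieltjes_on a b (\<lambda>x. F x + G x)) \<in> sets (stieltjes_on a b (\<lambda>x. F x + G x))"
    by (simp add: stieltjes_on_def sets_restrict_space_iff)
qed simp

lemma nn_integral_stieltjes_on_sum:
  assumes h: "h \<in> borel_measurable (stieltjes_on a b (\<lambda>x. F x + G x))"
  shows "(\<integral>\<^sup>+x. h x \<partial>stieltjes_on a b (\<lambda>x. F x + G x))
       = (\<integral>\<^sup>+x. h x \<partial>stieltjes_on a b F) + (\<integral>\<^sup>+x. h x \<partial>stieltjes_on a b G)"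
proof -
  have "(\<lambda>x. h x * indicator {a..b} x)
      \<in> borel_measurable (completion (interval_measure (\<lambda>x. F (max a (min b x)) + G (max a (min b x)))))"
    using h unfolding stieltjes_on_def
    by (subst (asm) borel_measurable_restrict_space_iff_ennreal) auto
  from nn_integral_completion_sum[OF _ _ interval_measure_clamp_sum this]
  show ?thesis
    unfolding stieltjes_on_def by (subst (1 2 3) nn_integral_restrict_space) auto
qed

lemma integrable_stieltjes_on_sum:
  fixes h :: "real \<Rightarrow> real"
  assumes "integrable (stieltjes_on a b F) h" "integrable (stieltjes_on a b G) h"
  shows "integrable (stieltjes_on a b (\<lambda>x. F x + G x)) h"
proof (rule integrableI_bounded)
  show h: "h \<in> borel_measurable (stieltjes_on a b (\<lambda>x. F x + G x))"
    using assms by (intro borel_measurable_stieltjes_on_sum) auto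
  show "(\<integral>\<^sup>+x. ennreal (norm (h x)) \<partial>stieltjes_on a b (\<lambda>x. F x + G x)) < \<infinity>"
    using assms h by (subst nn_integral_stieltjes_on_sum) (auto simp: integrable_iff_bounded)
qed

lemma integral_stieltjes_on_sum:
  fixes h :: "real \<Rightarrow> real"
  assumes hF: "integrable (stieltjes_on a b F) h" and hG: "integrable (stieltjes_on a b G) h"
    and nonneg: "\<And>x. 0 \<le> h x"
  shows "(LINT x|stieltjes_on a b (\<lambda>x. F x + G x). h x)
       = (LINT x|stieltjes_on a b F. h x) + (LINT x|stieltjes_on a b G. h x)"
proof -
  have h: "integrable (stieltjes_on a b (\<lambda>x. F x + G x)) h"
    using hF hG by (rule integrable_stieltjes_on_sum)
  then have "(\<lambda>x. ennreal (h x)) \<in> borel_measurable (stieltjes_on a b (\<lambda>x. F x + G x))"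
    by auto
  from nn_integral_stieltjes_on_sum[OF this] show ?thesis
    using h hF hG nonneg by (simp add: nn_integral_eq_integral integral_nonneg_AE flip: ennreal_plus)
qed

end

section \<open>Partitions and monotone functions\<close>

lemma is_partition_mono:
  assumes "is_partition u v n t" "i \<le> j" "j \<le> n"
  shows "t i \<le> t j"
  using assms(2,3)
proof (induction j rule: dec_induct)
  case (step m)
  then have "t m \<le> t (Suc m)" using assms(1) by (auto simp: is_partition_def intro: less_imp_le)
  with step show ?case by simp
qed simp

lemma total_variation_mono:
  assumes "mono_on {a..x} g" "a \<le> x"
  shows "total_variation a g x = g x - g a"
proof -
  have sum: "(\<Sum>i<n. \<bar>g (t (Suc i)) - g (t i)\<bar>) = g x - g a" if "is_partition a x n t" for n t
  proof -
    have "\<bar>g (t (Suc i)) - g (t i)\<bar> = g (t (Suc i)) - g (t i)" if "i < n" for i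
    proof -
      have "a \<le> t i" "t i \<le> t (Suc i)" "t (Suc i) \<le> x"
        using is_partition_mono[OF \<open>is_partition a x n t\<close>, of 0 i]
          is_partition_mono[OF \<open>is_partition a x n t\<close>, of i "Suc i"]
          is_partition_mono[OF \<open>is_partition a x n t\<close>, of "Suc i" n]
          \<open>is_partition a x n t\<close> \<open>i < n\<close> by (auto simp: is_partition_def)
      then show ?thesis using mono_onD[OF assms(1), of "t i" "t (Suc i)"] by auto
    qed
    then have "(\<Sum>i<n. \<bar>g (t (Suc i)) - g (t i)\<bar>) = (\<Sum>i<n. g (t (Suc i)) - g (t i))"
      by simp
    also have "\<dots> = g x - g a"
      using that sum_lessThan_telescope[of "\<lambda>i. g (t i)" n] by (simp add: is_partition_def)
    finally show ?thesis .
  qed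
  have "\<exists>n t. is_partition a x n t"
  proof (cases "a = x")
    case True
    then have "is_partition a x 0 (\<lambda>_. a)" by (simp add: is_partition_def)
    then show ?thesis by blast
  next
    case False
    then have "is_partition a x 1 (\<lambda>i. if i = 0 then a else x)"
      using assms(2) by (simp add: is_partition_def)
    then show ?thesis by blast
  qed
  then have "variation_sums g a x = {g x - g a}"
    using sum by (auto simp: variation_sums_def) metis
  then show ?thesis by (simp add: total_variation_def)
qed

section \<open>Square-integrable functions and conditional expectation\<close>

text \<open>The inequality of Cauchy and Schwarz against the constant \<open>1\<close>. The proof expands
  \<open>\<integral>(c V - \<integral>V)\<^sup>2 \<ge> 0\<close>, where \<open>c\<close> is the total mass.\<close>

lemma (in finite_measure) square_integral_le:
  fixes V :: "'a \<Rightarrow> real"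
  assumes V: "V \<in> borel_measurable M" and V2: "integrable M (\<lambda>x. (V x)\<^sup>2)"
  shows "(LINT x|M. V x)\<^sup>2 \<le> measure M (space M) * (LINT x|M. (V x)\<^sup>2)"
proof -
  let ?c = "measure M (space M)" and ?I = "LINT x|M. V x" and ?Q = "LINT x|M. (V x)\<^sup>2"
  have int: "integrable M V" using V V2 by (rule square_integrable_imp_integrable)
  show ?thesis
  proof (cases "?c = 0")
    case True
    then have "space M \<in> null_sets M" by (auto simp: null_sets_def emeasure_eq_measure)
    then have "AE x in M. V x = 0" by (auto intro: AE_I'[of "space M"])
    then have "?I = 0" by (rule integral_eq_zero_AE)
    then show ?thesis using True by simp
  next
    case False
    then have pos: "0 < ?c" by (simp add: less_le)
    have "0 \<le> (LINT x|M. (?c * V x - ?I)\<^sup>2)" by simp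
    also have "(LINT x|M. (?c * V x - ?I)\<^sup>2) = (LINT x|M. ?c\<^sup>2 * (V x)\<^sup>2 - 2 * ?c * ?I * V x + ?I\<^sup>2)"
      by (simp add: power2_eq_square algebra_simps)
    also have "\<dots> = ?c\<^sup>2 * ?Q - 2 * ?c * ?I * ?I + ?I\<^sup>2 * ?c"
      using int V2 by simp
    also have "\<dots> = ?c * (?c * ?Q - ?I\<^sup>2)"
      by (simp add: power2_eq_square algebra_simps)
    finally show ?thesis using pos by (simp add: zero_le_mult_iff)
  qed
qed

lemma integrable_square_add:
  fixes f g :: "'a \<Rightarrow> real"
  assumes [measurable]: "f \<in> borel_measurable M" "g \<in> borel_measurable M"
    and f2: "integrable M (\<lambda>x. (f x)\<^sup>2)" and g2: "integrable M (\<lambda>x. (g x)\<^sup>2)"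
  shows "integrable M (\<lambda>x. (f x + g x)\<^sup>2)"
    and "(LINT x|M. (f x + g x)\<^sup>2) \<le> 2 * (LINT x|M. (f x)\<^sup>2) + 2 * (LINT x|M. (g x)\<^sup>2)"
proof -
  have le: "(f x + g x)\<^sup>2 \<le> 2 * (f x)\<^sup>2 + 2 * (g x)\<^sup>2" for x
    using zero_le_power2[of "f x - g x"] by (simp add: power2_eq_square algebra_simps)
  have int: "integrable M (\<lambda>x. 2 * (f x)\<^sup>2 + 2 * (g x)\<^sup>2)"
    using f2 g2 by simp
  show fg: "integrable M (\<lambda>x. (f x + g x)\<^sup>2)"
    by (rule Bochner_Integration.integrable_bound[OF int]) (use le in \<open>auto intro: order_trans\<close>)
  have "(LINT x|M. (f x + g x)\<^sup>2) \<le> (LINT x|M. 2 * (f x)\<^sup>2 + 2 * (g x)\<^sup>2)"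
    using fg int le by (rule integral_mono)
  then show "(LINT x|M. (f x + g x)\<^sup>2) \<le> 2 * (LINT x|M. (f x)\<^sup>2) + 2 * (LINT x|M. (g x)\<^sup>2)"
    using f2 g2 by simp
qed

lemma integrable_square_diff:
  fixes f g :: "'a \<Rightarrow> real"
  assumes "f \<in> borel_measurable M" "g \<in> borel_measurable M"
    and "integrable M (\<lambda>x. (f x)\<^sup>2)" and "integrable M (\<lambda>x. (g x)\<^sup>2)"
  shows "integrable M (\<lambda>x. (f x - g x)\<^sup>2)"
    and "(LINT x|M. (f x - g x)\<^sup>2) \<le> 2 * (LINT x|M. (f x)\<^sup>2) + 2 * (LINT x|M. (g x)\<^sup>2)"
  using integrable_square_add[of f M "\<lambda>x. - g x"] assms by auto

lemma integrable_prod_of_squares: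
  fixes f g :: "'a \<Rightarrow> real"
  assumes [measurable]: "f \<in> borel_measurable M" "g \<in> borel_measurable M"
    and f2: "integrable M (\<lambda>x. (f x)\<^sup>2)" and g2: "integrable M (\<lambda>x. (g x)\<^sup>2)"
  shows "integrable M (\<lambda>x. f x * g x)"
proof -
  have "\<bar>f x * g x\<bar> \<le> \<bar>(f x)\<^sup>2 + (g x)\<^sup>2\<bar>" for x
  proof -
    have "0 \<le> (\<bar>f x\<bar> - \<bar>g x\<bar>)\<^sup>2" by simp
    then have "2 * (\<bar>f x\<bar> * \<bar>g x\<bar>) \<le> (f x)\<^sup>2 + (g x)\<^sup>2"
      by (simp add: power2_diff)
    moreover have "0 \<le> \<bar>f x\<bar> * \<bar>g x\<bar>" by simp
    ultimately show ?thesis unfolding abs_mult by linarith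
  qed
  then show ?thesis
    using f2 g2 by (intro Bochner_Integration.integrable_bound[OF Bochner_Integration.integrable_add[OF f2 g2]]) auto
qed

lemma (in prob_space) set_integral_tendsto_of_L2:
  fixes U :: "nat \<Rightarrow> 'a \<Rightarrow> real"
  assumes A: "A \<in> sets M"
    and Z: "Z \<in> borel_measurable M" "integrable M (\<lambda>x. (Z x)\<^sup>2)"
    and U: "\<And>k. U k \<in> borel_measurable M" "\<And>k. integrable M (\<lambda>x. (U k x)\<^sup>2)"
    and lim: "(\<lambda>k. LINT x|M. (U k x - Z x)\<^sup>2) \<longlonglongrightarrow> 0"
  shows "(\<lambda>k. LINT x|M. indicator A x * U k x) \<longlonglongrightarrow> (LINT x|M. indicator A x * Z x)"
proof -
  note [measurable] = A Z(1) U(1)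
  have int: "integrable M (\<lambda>x. indicator A x * V x)"
    if "V \<in> borel_measurable M" "integrable M (\<lambda>x. (V x)\<^sup>2)" for V :: "'a \<Rightarrow> real"
    using integrable_mult_indicator[OF A square_integrable_imp_integrable[OF that]] by simp
  have bound: "\<bar>(LINT x|M. indicator A x * U k x) - (LINT x|M. indicator A x * Z x)\<bar>
      \<le> sqrt (LINT x|M. (U k x - Z x)\<^sup>2)" for k
  proof -
    let ?D = "\<lambda>x. indicator A x * (U k x - Z x)"
    have D2: "integrable M (\<lambda>x. (U k x - Z x)\<^sup>2)"
      using integrable_square_diff(1)[OF U(1) Z(1) U(2) Z(2)] .
    have iD2: "integrable M (\<lambda>x. (?D x)\<^sup>2)"
      by (rule Bochner_Integration.integrable_bound[OF D2]) (auto simp: indicator_def)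
    have "(LINT x|M. ?D x)\<^sup>2 \<le> (LINT x|M. (?D x)\<^sup>2)"
      using square_integral_le[of ?D, OF _ iD2] by (simp add: prob_space)
    also have "\<dots> \<le> (LINT x|M. (U k x - Z x)\<^sup>2)"
      by (rule integral_mono[OF iD2 D2]) (auto simp: indicator_def)
    finally have "\<bar>LINT x|M. ?D x\<bar> \<le> sqrt (LINT x|M. (U k x - Z x)\<^sup>2)"
      by (simp add: real_le_rsqrt)
    moreover have "(LINT x|M. ?D x) = (LINT x|M. indicator A x * U k x) - (LINT x|M. indicator A x * Z x)"
      using int[OF U(1) U(2)] int[OF Z] by (simp add: right_diff_distrib)
    ultimately show ?thesis by simp
  qed
  have "(\<lambda>k. sqrt (LINT x|M. (U k x - Z x)\<^sup>2)) \<longlonglongrightarrow> 0"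
    using tendsto_real_sqrt[OF lim] by simp
  then have "(\<lambda>k. (LINT x|M. indicator A x * U k x) - (LINT x|M. indicator A x * Z x)) \<longlonglongrightarrow> 0"
    by (rule Lim_null_comparison[rotated]) (use bound in auto)
  then show ?thesis by (simp add: LIM_zero_iff)
qed

text \<open>Monotonicity of the conditional expectation, applied to \<open>U \<le> \<bar>U\<bar>\<close> and \<open>-U \<le> \<bar>U\<bar>\<close>.\<close>

lemma (in finite_measure_subalgebra) real_cond_exp_L1_le:
  assumes U: "integrable M U"
  shows "(LINT x|M. \<bar>real_cond_exp M F U x\<bar>) \<le> (LINT x|M. \<bar>U x\<bar>)"
proof -
  have "AE x in M. real_cond_exp M F U x \<le> real_cond_exp M F (\<lambda>x. \<bar>U x\<bar>) x"
    using U by (intro real_cond_exp_mono) auto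
  moreover have "AE x in M. real_cond_exp M F (\<lambda>x. - U x) x \<le> real_cond_exp M F (\<lambda>x. \<bar>U x\<bar>) x"
    using U by (intro real_cond_exp_mono) auto
  moreover have "AE x in M. real_cond_exp M F (\<lambda>x. - U x) x = - real_cond_exp M F U x"
    using real_cond_exp_cmult[OF U, of "-1"] by simp
  ultimately have "AE x in M. \<bar>real_cond_exp M F U x\<bar> \<le> real_cond_exp M F (\<lambda>x. \<bar>U x\<bar>) x"
    by eventually_elim auto
  then have "(LINT x|M. \<bar>real_cond_exp M F U x\<bar>) \<le> (LINT x|M. real_cond_exp M F (\<lambda>x. \<bar>U x\<bar>) x)"
    using U by (intro integral_mono_AE) (auto intro!: real_cond_exp_int)
  also have "\<dots> = (LINT x|M. \<bar>U x\<bar>)" using U by (intro real_cond_exp_int) auto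
  finally show ?thesis .
qed

text \<open>Since \<open>E[U k | F] = U k\<close>, the contraction property of the conditional expectation on \<open>L\<^sup>1\<close> gives
  \<open>E\<bar>Z - E[Z | F]\<bar> \<le> 2 E\<bar>U k - Z\<bar>\<close>, and the right-hand side tends to \<open>0\<close>.\<close>

lemma (in prob_space) L2_limit_measurable_version:
  fixes U :: "nat \<Rightarrow> 'a \<Rightarrow> real"
  assumes F: "subalgebra M F"
    and Z: "Z \<in> borel_measurable M" "integrable M (\<lambda>x. (Z x)\<^sup>2)"
    and UF: "\<And>k. U k \<in> borel_measurable F"
    and U2: "\<And>k. integrable M (\<lambda>x. (U k x)\<^sup>2)"
    and lim: "(\<lambda>k. LINT x|M. (U k x - Z x)\<^sup>2) \<longlonglongrightarrow> 0"
  shows "AE x in M. Z x = real_cond_exp M F Z x"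
proof -
  interpret F: finite_measure_subalgebra M F
    using F by unfold_locales
  let ?C = "real_cond_exp M F Z"
  have UM: "U k \<in> borel_measurable M" for k using measurable_from_subalg[OF F UF] .
  have Ui: "integrable M (U k)" for k using square_integrable_imp_integrable[OF UM U2] .
  have Zi: "integrable M Z" using square_integrable_imp_integrable[OF Z] .
  have Ci: "integrable M ?C" using F.real_cond_exp_int(1)[OF Zi] .
  have bound: "(LINT x|M. \<bar>Z x - ?C x\<bar>) \<le> 2 * sqrt (LINT x|M. (U k x - Z x)\<^sup>2)" for k
  proof -
    have D: "integrable M (\<lambda>x. (U k x - Z x)\<^sup>2)"
      using integrable_square_diff(1)[OF UM Z(1) U2 Z(2)] .
    have "(LINT x|M. \<bar>U k x - Z x\<bar>)\<^sup>2 \<le> (LINT x|M. (U k x - Z x)\<^sup>2)"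
      using square_integral_le[of "\<lambda>x. \<bar>U k x - Z x\<bar>"] UM Z D by (simp add: prob_space)
    then have L1: "(LINT x|M. \<bar>U k x - Z x\<bar>) \<le> sqrt (LINT x|M. (U k x - Z x)\<^sup>2)"
      by (simp add: real_le_rsqrt)
    have "AE x in M. real_cond_exp M F (\<lambda>x. U k x - Z x) x = U k x - ?C x"
      using F.real_cond_exp_diff[OF Ui Zi, of k] F.real_cond_exp_F_meas[OF Ui UF, of k]
      by eventually_elim simp
    then have "(LINT x|M. \<bar>U k x - ?C x\<bar>) = (LINT x|M. \<bar>real_cond_exp M F (\<lambda>x. U k x - Z x) x\<bar>)"
      by (intro integral_cong_AE) (use UM in auto)
    also have "\<dots> \<le> (LINT x|M. \<bar>U k x - Z x\<bar>)"
      using Ui Zi by (intro F.real_cond_exp_L1_le) auto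
    finally have C: "(LINT x|M. \<bar>U k x - ?C x\<bar>) \<le> (LINT x|M. \<bar>U k x - Z x\<bar>)" .
    have "(LINT x|M. \<bar>Z x - ?C x\<bar>) \<le> (LINT x|M. \<bar>U k x - Z x\<bar> + \<bar>U k x - ?C x\<bar>)"
      using Ui Zi Ci by (intro integral_mono) auto
    also have "\<dots> = (LINT x|M. \<bar>U k x - Z x\<bar>) + (LINT x|M. \<bar>U k x - ?C x\<bar>)"
      using Ui Zi Ci by (intro Bochner_Integration.integral_add) auto
    finally show ?thesis using L1 C by linarith
  qed
  have "(\<lambda>k. 2 * sqrt (LINT x|M. (U k x - Z x)\<^sup>2)) \<longlonglongrightarrow> 0"
    using tendsto_mult_right_zero[OF tendsto_real_sqrt[OF lim, simplified], of 2] .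
  then have "(LINT x|M. \<bar>Z x - ?C x\<bar>) \<le> 0"
    by (rule LIMSEQ_le_const) (use bound in auto)
  then have "(LINT x|M. \<bar>Z x - ?C x\<bar>) = 0"
    by (intro antisym) auto
  then have "AE x in M. \<bar>Z x - ?C x\<bar> = 0"
    using Zi Ci by (subst (asm) integral_nonneg_eq_0_iff_AE) auto
  then show ?thesis by auto
qed

section \<open>Increments and the past\<close>

lemma (in prob_space) indep_var_weaken:
  assumes ind: "indep_set S (sigma_sets (space M) {V -` C \<inter> space M | C. C \<in> sets borel})"
    and SF: "sets F \<subseteq> S" and F: "subalgebra M F"
    and U: "U \<in> borel_measurable F" and V: "V \<in> borel_measurable M"
  shows "indep_var borel (U :: _ \<Rightarrow> real) borel (V :: _ \<Rightarrow> real)"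
proof -
  have sp: "space F = space M" using F by (simp add: subalgebra_def)
  have "sigma_sets (space M) {U -` A \<inter> space M | A. A \<in> sets borel} \<subseteq> sets F"
    unfolding sp[symmetric] using U by (intro sets.sigma_sets_subset) (auto simp: measurable_sets)
  then have sub: "sigma_sets (space M) {U -` A \<inter> space M | A. A \<in> sets borel} \<subseteq> S"
    using SF by auto
  show ?thesis
    unfolding indep_var_eq
  proof (intro conjI)
    show "random_variable borel U" using measurable_from_subalg[OF F U] .
    show "indep_set (sigma_sets (space M) {U -` A \<inter> space M | A. A \<in> sets borel})
        (sigma_sets (space M) {V -` C \<inter> space M | C. C \<in> sets borel})"
      using sub indep_setD_ev1[OF ind] indep_setD_ev2[OF ind]
      by (intro indep_setI) (auto intro: indep_setD[OF ind])
  qed fact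
qed

text \<open>Additivity of the process speaks about partitions, cylinder events about arbitrary finite sets of
  times. Sorting the set, enlarged by \<open>a\<close> and \<open>s\<close>, and adding \<open>q\<close> at the end gives a partition whose last
  step is exactly \<open>[s, q]\<close>.\<close>

lemma partition_through_finite_set:
  assumes J: "finite J" "J \<subseteq> {a..s}" and as: "a \<le> s" "s < q"
  obtains n t where "is_partition a q (Suc n) t" "t n = s" "J \<subseteq> t ` {..n}" "t (Suc n) = q"
proof -
  define K where "K = insert a (insert s J)"
  define l where "l = sorted_list_of_set K"
  define n where "n = card K - 1"
  define t where "t i = (if i \<le> n then l ! i else q)" for i
  have K: "finite K" "K \<noteq> {}" "K \<subseteq> {a..s}" using J as by (auto simp: K_def)
  have set_l: "set l = K" and sorted: "sorted_wrt (<) l" and len: "length l = Suc n"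
    using K by (auto simp: l_def n_def card_gt_0_iff)
  have inc: "l ! i < l ! j" if "i < j" "j \<le> n" for i j
    using sorted_wrt_nth_less[OF sorted] that len by auto
  have l_in: "l ! i \<in> {a..s}" if "i \<le> n" for i
    using that len set_l K(3) nth_mem[of i l] by auto
  have surj: "\<exists>i\<le>n. l ! i = x" if "x \<in> K" for x
    using that len set_l by (metis in_set_conv_nth less_Suc_eq_le)
  have l0: "l ! 0 = a"
  proof -
    obtain i where "i \<le> n" "l ! i = a" using surj[of a] by (auto simp: K_def)
    then show ?thesis using inc[of 0 i] l_in[of 0] by (cases "i = 0") auto
  qed
  have ln: "l ! n = s"
  proof -
    obtain i where "i \<le> n" "l ! i = s" using surj[of s] by (auto simp: K_def)
    then show ?thesis using inc[of i n] l_in[of n] by (cases "i = n") auto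
  qed
  show thesis
  proof
    show "is_partition a q (Suc n) t"
      using l0 ln as inc by (auto simp: is_partition_def t_def less_Suc_eq_le le_less)
    show "t n = s" "t (Suc n) = q" by (simp_all add: t_def ln)
    show "J \<subseteq> t ` {..n}"
    proof
      fix x assume "x \<in> J"
      then obtain i where "i \<le> n" "l ! i = x" using surj[of x] by (auto simp: K_def)
      then show "x \<in> t ` {..n}" by (auto simp: t_def)
    qed
  qed
qed

locale yeh_with_increasing_mean = prob_space P
  for P :: "'w measure" and X :: "real \<Rightarrow> 'w \<Rightarrow> real" and a b :: real and lam \<rho> :: "real \<Rightarrow> real" +
  assumes less: "a < b"
    and parameters: "yeh_parameters a b lam \<rho>"
    and process: "yeh_process P a b lam \<rho> X"
    and mono_lam: "mono_on {a..b} lam"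
begin

abbreviation "\<F> \<equiv> natural_filtration P a X"

lemma X_measurable: "a \<le> t \<Longrightarrow> t \<le> b \<Longrightarrow> X t \<in> borel_measurable P"
  using process by (simp add: yeh_process_def)

lemma space_filtration [simp]: "space (\<F> t) = space P"
  by (simp add: natural_filtration_def space_measure_of_conv)

lemma sets_filtration:
  "sets (\<F> t) = sigma_sets (space P) {X s -` A \<inter> space P | s A. s \<in> {a..t} \<and> A \<in> sets borel}"
  unfolding natural_filtration_def by (rule sets_measure_of) auto

lemma sets_filtration_mono: "s \<le> t \<Longrightarrow> sets (\<F> s) \<subseteq> sets (\<F> t)"
  unfolding sets_filtration by (intro sigma_sets_mono') (auto, force)

lemma subalgebra_filtration:
  assumes "t \<le> b" shows "subalgebra P (\<F> t)"
proof -
  have "sets (\<F> t) \<subseteq> sets P"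
    unfolding sets_filtration
    using assms X_measurable by (intro sets.sigma_sets_subset) (auto intro!: measurable_sets)
  then show ?thesis by (simp add: subalgebra_def)
qed

lemma X_measurable_filtration: "a \<le> r \<Longrightarrow> r \<le> t \<Longrightarrow> X r \<in> borel_measurable (\<F> t)"
  by (rule measurableI) (auto simp: sets_filtration)

text \<open>Along a partition of \<open>[a, q]\<close> that contains all times of \<open>J\<close>, each \<open>X (t i)\<close> with \<open>t i \<le> s\<close> is the sum of
  \<open>X a\<close> and the increments up to \<open>i\<close>. The cylinder event is therefore a function of the first \<open>n + 1\<close>
  members of an independent family, whose remaining member is the increment from \<open>s\<close> to \<open>q\<close>.\<close>

lemma indep_cylinder_increment:
  assumes s: "a \<le> s" "s < q" "q \<le> b" and J: "finite J" "J \<subseteq> {a..s}"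
    and B: "\<And>r. r \<in> J \<Longrightarrow> B r \<in> sets borel" and C: "C \<in> sets borel"
  shows "prob ({\<omega> \<in> space P. \<forall>r\<in>J. X r \<omega> \<in> B r} \<inter> {\<omega> \<in> space P. X q \<omega> - X s \<omega> \<in> C})
       = prob {\<omega> \<in> space P. \<forall>r\<in>J. X r \<omega> \<in> B r} * prob {\<omega> \<in> space P. X q \<omega> - X s \<omega> \<in> C}"
proof -
  obtain n t where part: "is_partition a q (Suc n) t" and t: "t n = s" "J \<subseteq> t ` {..n}" "t (Suc n) = q"
    using partition_through_finite_set[OF J s(1,2)] .
  define W where "W = (\<lambda>i. if i = 0 then X (t 0) else (\<lambda>\<omega>. X (t i) \<omega> - X (t (i - 1)) \<omega>))"
  have "additive_process P a b X" using process by (simp add: yeh_process_def)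
  then have "indep_vars (\<lambda>_. borel) W {..Suc n}"
    using part t s unfolding additive_process_def W_def by auto
  then have ind: "indep_var (PiM {..n} (\<lambda>_. borel)) (\<lambda>\<omega>. restrict (\<lambda>i. W i \<omega>) {..n})
      (PiM {Suc n} (\<lambda>_. borel)) (\<lambda>\<omega>. restrict (\<lambda>i. W i \<omega>) {Suc n})"
    by (rule indep_var_restrict) auto
  have X_sum: "(\<Sum>j\<le>i. W j \<omega>) = X (t i) \<omega>" for i \<omega>
    by (induction i) (auto simp: W_def)
  define past where "past = {w \<in> space (PiM {..n} (\<lambda>_. borel :: real measure)).
    \<forall>i\<in>{i. i \<le> n \<and> t i \<in> J}. (\<Sum>j\<le>i. w j) \<in> B (t i)}"
  define future where "future = {w \<in> space (PiM {Suc n} (\<lambda>_. borel :: real measure)). w (Suc n) \<in> C}"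
  have "past \<in> sets (PiM {..n} (\<lambda>_. borel))"
    unfolding past_def
  proof (rule sets.sets_Collect_finite_All)
    fix i assume i: "i \<in> {i. i \<le> n \<and> t i \<in> J}"
    have "(\<lambda>w. \<Sum>j\<le>i. w j) \<in> borel_measurable (PiM {..n} (\<lambda>_. borel :: real measure))"
      using i by (intro borel_measurable_sum measurable_component_singleton) auto
    then show "{w \<in> space (PiM {..n} (\<lambda>_. borel)). (\<Sum>j\<le>i. w j) \<in> B (t i)} \<in> sets (PiM {..n} (\<lambda>_. borel :: real measure))"
      using B i by (auto intro!: measurable_sets_Collect)
  qed auto
  moreover have "future \<in> sets (PiM {Suc n} (\<lambda>_. borel))"
  proof -
    have "(\<lambda>w. w (Suc n)) \<in> borel_measurable (PiM {Suc n} (\<lambda>_. borel :: real measure))"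
      by (intro measurable_component_singleton) auto
    then show ?thesis unfolding future_def using C by (auto intro!: measurable_sets_Collect)
  qed
  moreover have "(\<lambda>\<omega>. restrict (\<lambda>i. W i \<omega>) {..n}) -` past \<inter> space P = {\<omega> \<in> space P. \<forall>r\<in>J. X r \<omega> \<in> B r}"
  proof -
    have "(\<Sum>j\<le>i. restrict (\<lambda>i. W i \<omega>) {..n} j) = X (t i) \<omega>" if "i \<le> n" for i \<omega>
      using X_sum[of \<omega> i] that by (auto intro: sum.cong)
    then show ?thesis
      using t(2) by (auto simp: past_def space_PiM PiE_iff)
  qed
  moreover have "(\<lambda>\<omega>. restrict (\<lambda>i. W i \<omega>) {Suc n}) -` future \<inter> space P = {\<omega> \<in> space P. X q \<omega> - X s \<omega> \<in> C}"
    by (auto simp: future_def space_PiM PiE_iff W_def t)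
  moreover have "(\<lambda>\<omega>. (restrict (\<lambda>i. W i \<omega>) {..n}, restrict (\<lambda>i. W i \<omega>) {Suc n})) -` (past \<times> future) \<inter> space P
      = ((\<lambda>\<omega>. restrict (\<lambda>i. W i \<omega>) {..n}) -` past \<inter> space P)
        \<inter> ((\<lambda>\<omega>. restrict (\<lambda>i. W i \<omega>) {Suc n}) -` future \<inter> space P)"
    by auto
  ultimately show ?thesis
    using indep_varD[OF ind, of past future] by simp
qed

text \<open>Cylinder events form an intersection-stable generator of the filtration at time \<open>s\<close>, so their
  independence of the increment extends to the whole \<open>\<sigma>\<close>-algebra.\<close>

lemma indep_past_increment:
  assumes s: "a \<le> s" "s < q" "q \<le> b" and U: "U \<in> borel_measurable (\<F> s)"
  shows "indep_var borel (U :: _ \<Rightarrow> real) borel (\<lambda>\<omega>. X q \<omega> - X s \<omega>)"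
proof -
  let ?D = "\<lambda>\<omega>. X q \<omega> - X s \<omega>"
  define cyl where "cyl = {{\<omega> \<in> space P. \<forall>r\<in>J. X r \<omega> \<in> B r} | J B.
    finite J \<and> J \<subseteq> {a..s} \<and> (\<forall>r\<in>J. B r \<in> sets (borel :: real measure))}"
  define inc where "inc = {?D -` C \<inter> space P | C. C \<in> sets (borel :: real measure)}"
  have D: "?D \<in> borel_measurable P" using s X_measurable by auto
  have X: "X r \<in> borel_measurable P" if "r \<in> {a..s}" for r using that s X_measurable by auto
  have "indep_set cyl inc"
  proof (rule indep_setI)
    show "cyl \<subseteq> events"
    proof
      fix A assume "A \<in> cyl"
      then obtain J B where A: "A = {\<omega> \<in> space P. \<forall>r\<in>J. X r \<omega> \<in> B r}"
        and J: "finite J" "J \<subseteq> {a..s}" and B: "\<forall>r\<in>J. B r \<in> sets borel"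
        by (auto simp: cyl_def)
      have "{\<omega> \<in> space P. X r \<omega> \<in> B r} \<in> events" if "r \<in> J" for r
        using measurable_sets_Collect[OF X, of r "\<lambda>x. x \<in> B r"] J B that by auto
      then show "A \<in> events" unfolding A using J by (intro sets.sets_Collect_finite_All) auto
    qed
    show "inc \<subseteq> events" using D by (auto simp: inc_def)
    show "prob (A \<inter> E) = prob A * prob E" if "A \<in> cyl" "E \<in> inc" for A E
    proof -
      obtain J B where A: "A = {\<omega> \<in> space P. \<forall>r\<in>J. X r \<omega> \<in> B r}"
        and J: "finite J" "J \<subseteq> {a..s}" and B: "\<forall>r\<in>J. B r \<in> sets borel"
        using \<open>A \<in> cyl\<close> by (auto simp: cyl_def)
      obtain C where E: "E = {\<omega> \<in> space P. ?D \<omega> \<in> C}" and C: "C \<in> sets borel"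
        using \<open>E \<in> inc\<close> by (auto simp: inc_def)
      show ?thesis unfolding A E using s J B C by (intro indep_cylinder_increment) auto
    qed
  qed
  moreover have "Int_stable cyl"
  proof (rule Int_stableI)
    fix A A' assume "A \<in> cyl" "A' \<in> cyl"
    then obtain J B J' B' where A: "A = {\<omega> \<in> space P. \<forall>r\<in>J. X r \<omega> \<in> B r}" "A' = {\<omega> \<in> space P. \<forall>r\<in>J'. X r \<omega> \<in> B' r}"
      and J: "finite J" "J \<subseteq> {a..s}" "finite J'" "J' \<subseteq> {a..s}"
      and B: "\<forall>r\<in>J. B r \<in> sets borel" "\<forall>r\<in>J'. B' r \<in> sets borel"
      by (auto simp: cyl_def)
    let ?B = "\<lambda>r. (if r \<in> J then B r else UNIV) \<inter> (if r \<in> J' then B' r else UNIV)"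
    have "A \<inter> A' = {\<omega> \<in> space P. \<forall>r\<in>J \<union> J'. X r \<omega> \<in> ?B r}"
      unfolding A by auto
    moreover have "\<forall>r\<in>J \<union> J'. ?B r \<in> sets borel" using B by auto
    ultimately show "A \<inter> A' \<in> cyl"
      unfolding cyl_def using J by (intro CollectI exI[of _ "J \<union> J'"] exI[of _ ?B]) auto
  qed
  moreover have "Int_stable inc"
  proof (rule Int_stableI)
    fix E E' assume "E \<in> inc" "E' \<in> inc"
    then obtain C C' where E: "E = ?D -` C \<inter> space P" "E' = ?D -` C' \<inter> space P"
      and C: "C \<in> sets borel" "C' \<in> sets borel"
      by (auto simp: inc_def)
    have "E \<inter> E' = ?D -` (C \<inter> C') \<inter> space P" unfolding E by auto
    then show "E \<inter> E' \<in> inc" unfolding inc_def using C by (intro CollectI exI[of _ "C \<inter> C'"]) auto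
  qed
  ultimately have ind: "indep_set (sigma_sets (space P) cyl) (sigma_sets (space P) inc)"
    by (rule indep_set_sigma_sets)
  have "sets (\<F> s) \<subseteq> sigma_sets (space P) cyl"
    unfolding sets_filtration
  proof (rule sigma_sets_mono', safe)
    fix r and A :: "real set" assume r: "r \<in> {a..s}" "A \<in> sets borel"
    then show "X r -` A \<inter> space P \<in> cyl"
      unfolding cyl_def by (intro CollectI exI[of _ "{r}"] exI[of _ "\<lambda>_. A"]) auto
  qed
  moreover have "subalgebra P (\<F> s)" using s by (intro subalgebra_filtration) simp
  ultimately show ?thesis using indep_var_weaken[OF ind[unfolded inc_def] _ _ U D] by blast
qed

text \<open>If \<open>\<rho> s = \<rho> t\<close>, the prescribed normal density has standard deviation \<open>0\<close>; by the convention
  \<open>x / 0 = 0\<close> it vanishes identically and cannot be the density of a random variable.\<close>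

lemma rho_strict_mono:
  assumes "a \<le> s" "s < t" "t \<le> b"
  shows "\<rho> s < \<rho> t"
proof (rule ccontr)
  assume "\<not> ?thesis"
  moreover have mono: "mono_on {a..b} \<rho>"
    using parameters by (simp add: yeh_parameters_def)
  ultimately have eq: "\<rho> t = \<rho> s" using mono_onD[OF mono, of s t] assms by auto
  define D where "D = (\<lambda>\<omega>. X t \<omega> - X s \<omega>)"
  have D: "distributed P lborel D (normal_density (lam t - lam s) (sqrt (\<rho> t - \<rho> s)))"
    using process assms by (simp add: yeh_process_def D_def)
  have "prob_space (distr P lborel D)"
    using distributed_measurable[OF D] by (rule prob_space_distr)
  then have "emeasure (distr P lborel D) UNIV = 1"
    using prob_space.emeasure_space_1 by fastforce
  moreover have "emeasure (distr P lborel D) UNIV = 0"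
    unfolding distributed_distr_eq_density[OF D] by (simp add: eq normal_density_def emeasure_density)
  ultimately show False by simp
qed

lemma increment_moments:
  assumes "a \<le> s" "s \<le> t" "t \<le> b"
  shows "integrable P (\<lambda>\<omega>. (X t \<omega> - X s \<omega>)\<^sup>2)"
    and "expectation (\<lambda>\<omega>. X t \<omega> - X s \<omega>) = lam t - lam s"
    and "expectation (\<lambda>\<omega>. (X t \<omega> - X s \<omega>)\<^sup>2) = (\<rho> t - \<rho> s) + (lam t - lam s)\<^sup>2"
proof -
  define D where "D = (\<lambda>\<omega>. X t \<omega> - X s \<omega>)"
  have "integrable P (\<lambda>\<omega>. (D \<omega>)\<^sup>2) \<and> expectation D = lam t - lam s
     \<and> expectation (\<lambda>\<omega>. (D \<omega>)\<^sup>2) = (\<rho> t - \<rho> s) + (lam t - lam s)\<^sup>2"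
  proof (cases "s = t")
    case True
    then show ?thesis by (simp add: D_def)
  next
    case False
    then have st: "s < t" using assms by simp
    have pos: "0 < sqrt (\<rho> t - \<rho> s)" using rho_strict_mono[of s t] assms st by simp
    have D: "distributed P lborel D (normal_density (lam t - lam s) (sqrt (\<rho> t - \<rho> s)))"
      using process assms st by (simp add: yeh_process_def D_def)
    have [measurable]: "D \<in> borel_measurable P"
      using distributed_measurable[OF D] by simp
    have E: "expectation D = lam t - lam s"
      using normal_distributed_expectation[OF pos D] .
    have V: "variance D = \<rho> t - \<rho> s"
      using normal_distributed_variance[OF pos D] pos by simp
    \<comment> \<open>A non-integrable function has Bochner integral \<open>0\<close>, whereas this variance is positive.\<close>
    have "integrable P (\<lambda>\<omega>. (D \<omega> - expectation D)\<^sup>2)"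
      using V pos not_integrable_integral_eq by fastforce
    from integrable_square_add(1)[OF _ _ this, of "\<lambda>_. expectation D"]
    have D2: "integrable P (\<lambda>\<omega>. (D \<omega>)\<^sup>2)" by simp
    then have "integrable P D" by (rule square_integrable_imp_integrable[rotated]) simp
    then show ?thesis using variance_eq[OF _ D2] D2 E V by simp
  qed
  then show "integrable P (\<lambda>\<omega>. (X t \<omega> - X s \<omega>)\<^sup>2)"
    and "expectation (\<lambda>\<omega>. X t \<omega> - X s \<omega>) = lam t - lam s"
    and "expectation (\<lambda>\<omega>. (X t \<omega> - X s \<omega>)\<^sup>2) = (\<rho> t - \<rho> s) + (lam t - lam s)\<^sup>2"
    by (simp_all add: D_def)
qed

end

section \<open>Integrals of step functions\<close>

text \<open>A pair \<open>(g, Y)\<close> of a step function on \<open>[u, v)\<close> and its integral. The pairs form the linear span of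
  the pairs \<open>(1\<^bsub>[u, q)\<^esub>, X q - X u)\<close>. With all generating intervals starting at the same point,
  step functions on different partitions can be added without passing to a common refinement, and
  linear or bilinear identities need to be checked on generators only.\<close>

inductive elementary_integral ::
    "(real \<Rightarrow> 'w \<Rightarrow> real) \<Rightarrow> real \<Rightarrow> real \<Rightarrow> (real \<Rightarrow> real) \<Rightarrow> ('w \<Rightarrow> real) \<Rightarrow> bool"
  for X :: "real \<Rightarrow> 'w \<Rightarrow> real" and u v :: real
where
  zero: "elementary_integral X u v (\<lambda>_. 0) (\<lambda>_. 0)"
| increment: "u \<le> q \<Longrightarrow> q \<le> v \<Longrightarrow>
    elementary_integral X u v (indicator {u..<q}) (\<lambda>\<omega>. X q \<omega> - X u \<omega>)"
| add: "elementary_integral X u v g Y \<Longrightarrow> elementary_integral X u v g' Y' \<Longrightarrow>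
    elementary_integral X u v (\<lambda>x. g x + g' x) (\<lambda>\<omega>. Y \<omega> + Y' \<omega>)"
| scale: "elementary_integral X u v g Y \<Longrightarrow>
    elementary_integral X u v (\<lambda>x. c * g x) (\<lambda>\<omega>. c * Y \<omega>)"

lemma elementary_integral_diff:
  assumes "elementary_integral X u v g Y" "elementary_integral X u v g' Y'"
  shows "elementary_integral X u v (\<lambda>x. g x - g' x) (\<lambda>\<omega>. Y \<omega> - Y' \<omega>)"
  using elementary_integral.add[OF assms(1) elementary_integral.scale[OF assms(2), of "-1"]] by simp

lemma elementary_integral_sum:
  assumes "finite I" and "\<And>i. i \<in> I \<Longrightarrow> elementary_integral X u v (g i) (Y i)"
  shows "elementary_integral X u v (\<lambda>x. \<Sum>i\<in>I. g i x) (\<lambda>\<omega>. \<Sum>i\<in>I. Y i \<omega>)"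
  using assms
  by (induction I rule: finite_induct) (auto intro: elementary_integral.zero elementary_integral.add)

lemma elementary_integral_interval:
  assumes "u \<le> p" "p \<le> q" "q \<le> v"
  shows "elementary_integral X u v (indicator {p..<q}) (\<lambda>\<omega>. X q \<omega> - X p \<omega>)"
proof -
  have "(indicator {p..<q} :: real \<Rightarrow> real) = (\<lambda>x. indicator {u..<q} x - indicator {u..<p} x)"
    using assms by (auto simp: fun_eq_iff indicator_def)
  then show ?thesis
    using elementary_integral_diff[OF elementary_integral.increment elementary_integral.increment, of u q v p X] assms
    by simp
qed

lemma elementary_integral_mono:
  assumes "elementary_integral X u v g Y" "u' \<le> u" "v \<le> v'"
  shows "elementary_integral X u' v' g Y"
  using assms(1)
proof induction
  case (increment q)
  then show ?case using assms by (intro elementary_integral_interval) auto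
qed (auto intro: elementary_integral.intros)

lemma elementary_integral_step_fun:
  assumes t: "is_partition u v n t"
  shows "elementary_integral X u v (step_fun n t c) (step_integral X n t c)"
proof -
  have "elementary_integral X u v (\<lambda>s. c i * indicator {t i..<t (Suc i)} s) (\<lambda>\<omega>. c i * (X (t (Suc i)) \<omega> - X (t i) \<omega>))"
    if "i < n" for i
  proof -
    have "u \<le> t i" "t i \<le> t (Suc i)" "t (Suc i) \<le> v"
      using is_partition_mono[OF t, of 0 i] is_partition_mono[OF t, of i "Suc i"]
        is_partition_mono[OF t, of "Suc i" n] t that by (auto simp: is_partition_def)
    then show ?thesis by (intro elementary_integral.scale elementary_integral_interval)
  qed
  from elementary_integral_sum[of "{..<n}", OF _ this] show ?thesis
    unfolding step_fun_def[abs_def] step_integral_def[abs_def] by simp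
qed

text \<open>Splitting the integrand at \<open>s\<close> separates the part of the integral that is known at time \<open>s\<close> from a
  part that depends only on later increments.\<close>

lemma elementary_integral_split:
  assumes "elementary_integral X u v g Y" "u \<le> s" "s \<le> v"
  shows "\<exists>Y1 Y2. elementary_integral X u s (\<lambda>x. g x * indicator {u..<s} x) Y1 \<and>
    elementary_integral X s v (\<lambda>x. g x * indicator {s..<v} x) Y2 \<and> Y = (\<lambda>\<omega>. Y1 \<omega> + Y2 \<omega>)"
  using assms(1)
proof induction
  case zero
  show ?case
    using elementary_integral.zero[of X u s] elementary_integral.zero[of X s v]
    by (intro exI[of _ "\<lambda>_. 0"]) simp
next
  case (increment q)
  show ?case
  proof (cases "q \<le> s")
    case True
    then have "(\<lambda>x. indicator {u..<q} x * indicator {u..<s} x) = (indicator {u..<q} :: real \<Rightarrow> real)"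
      "(\<lambda>x. indicator {u..<q} x * indicator {s..<v} x) = (\<lambda>_. 0 :: real)"
      by (auto simp: indicator_def)
    then show ?thesis
      using elementary_integral.increment[of u q s X] elementary_integral.zero[of X s v] increment True
      by (intro exI[of _ "\<lambda>\<omega>. X q \<omega> - X u \<omega>"] exI[of _ "\<lambda>_. 0"]) simp
  next
    case False
    then have "(\<lambda>x. indicator {u..<q} x * indicator {u..<s} x) = (indicator {u..<s} :: real \<Rightarrow> real)"
      "(\<lambda>x. indicator {u..<q} x * indicator {s..<v} x) = (indicator {s..<q} :: real \<Rightarrow> real)"
      using assms(2) increment by (auto simp: indicator_def)
    then show ?thesis
      using elementary_integral.increment[of u s s X] elementary_integral.increment[of s q v X] increment False assms(2)
      by (intro exI[of _ "\<lambda>\<omega>. X s \<omega> - X u \<omega>"] exI[of _ "\<lambda>\<omega>. X q \<omega> - X s \<omega>"]) simp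
  qed
next
  case (add g Y g' Y')
  then obtain Y1 Y2 Y1' Y2' where
    "elementary_integral X u s (\<lambda>x. g x * indicator {u..<s} x) Y1"
    "elementary_integral X s v (\<lambda>x. g x * indicator {s..<v} x) Y2"
    "elementary_integral X u s (\<lambda>x. g' x * indicator {u..<s} x) Y1'"
    "elementary_integral X s v (\<lambda>x. g' x * indicator {s..<v} x) Y2'"
    "Y = (\<lambda>\<omega>. Y1 \<omega> + Y2 \<omega>)" "Y' = (\<lambda>\<omega>. Y1' \<omega> + Y2' \<omega>)" by blast
  then show ?case
    by (intro exI[of _ "\<lambda>\<omega>. Y1 \<omega> + Y1' \<omega>"] exI[of _ "\<lambda>\<omega>. Y2 \<omega> + Y2' \<omega>"])
       (auto simp: distrib_right intro: elementary_integral.add)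
next
  case (scale g Y c)
  then obtain Y1 Y2 where
    "elementary_integral X u s (\<lambda>x. g x * indicator {u..<s} x) Y1"
    "elementary_integral X s v (\<lambda>x. g x * indicator {s..<v} x) Y2"
    "Y = (\<lambda>\<omega>. Y1 \<omega> + Y2 \<omega>)" by blast
  then show ?case
    by (intro exI[of _ "\<lambda>\<omega>. c * Y1 \<omega>"] exI[of _ "\<lambda>\<omega>. c * Y2 \<omega>"])
       (auto simp: distrib_left mult.assoc intro: elementary_integral.scale)
qed

lemma elementary_integrand_borel:
  assumes "elementary_integral X u v g Y"
  shows "g \<in> borel_measurable borel"
  using assms by induction auto

lemma elementary_integrand_bounded:
  assumes "elementary_integral X u v g Y"
  shows "\<exists>B. \<forall>x. \<bar>g x\<bar> \<le> B"
  using assms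
proof induction
  case zero
  show ?case by auto
next
  case (increment q)
  show ?case by (intro exI[of _ 1]) (auto simp: indicator_def)
next
  case (add g Y g' Y')
  then obtain B B' where "\<And>x. \<bar>g x\<bar> \<le> B" "\<And>x. \<bar>g' x\<bar> \<le> B'" by blast
  then have "\<bar>g x + g' x\<bar> \<le> B + B'" for x
    by (meson abs_triangle_ineq add_mono order_trans)
  then show ?case by blast
next
  case (scale g Y c)
  then obtain B where "\<And>x. \<bar>g x\<bar> \<le> B" by blast
  then have "\<bar>c * g x\<bar> \<le> \<bar>c\<bar> * B" for x
    by (simp add: abs_mult mult_left_mono)
  then show ?case by blast
qed

context yeh_with_increasing_mean
begin

abbreviation "mu_rho \<equiv> stieltjes_on a b \<rho>"
abbreviation "mu_lam \<equiv> stieltjes_on a b (total_variation a lam)"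
abbreviation "mu_sum \<equiv> stieltjes_on a b (\<lambda>u. \<rho> u + total_variation a lam u)"

lemma total_variation_lam: "x \<in> {a..b} \<Longrightarrow> total_variation a lam x = lam x - lam a"
  by (intro total_variation_mono mono_on_subset[OF mono_lam]) auto

lemma regular_\<rho>: "mono_on {a..b} \<rho>" "continuous_on {a..b} \<rho>"
  using parameters by (auto simp: yeh_parameters_def)

lemma regular_tv: "mono_on {a..b} (total_variation a lam)" "continuous_on {a..b} (total_variation a lam)"
proof -
  show "mono_on {a..b} (total_variation a lam)"
    using mono_onD[OF mono_lam] by (intro mono_onI) (auto simp: total_variation_lam)
  have "continuous_on {a..b} (\<lambda>x. lam x - lam a)"
    using parameters by (intro continuous_intros) (auto simp: yeh_parameters_def)
  then show "continuous_on {a..b} (total_variation a lam)"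
    by (rule continuous_on_eq) (simp add: total_variation_lam)
qed

lemma finite_measure_mu_rho: "finite_measure mu_rho"
  using less regular_\<rho> by (intro finite_measure_stieltjes_on) auto

lemma finite_measure_mu_lam: "finite_measure mu_lam"
  using less regular_tv by (intro finite_measure_stieltjes_on) auto

lemma measure_mu_rho: "a \<le> p \<Longrightarrow> p \<le> q \<Longrightarrow> q \<le> b \<Longrightarrow> measure mu_rho {p..<q} = \<rho> q - \<rho> p"
  using less regular_\<rho> by (intro measure_stieltjes_on_Ico) auto

lemma measure_mu_lam: "a \<le> p \<Longrightarrow> p \<le> q \<Longrightarrow> q \<le> b \<Longrightarrow> measure mu_lam {p..<q} = lam q - lam p"
  using less regular_tv by (subst measure_stieltjes_on_Ico) (auto simp: total_variation_lam)

lemma integral_indicator_mu_rho: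
  assumes "a \<le> p" "p \<le> q" "q \<le> b"
  shows "(LINT x|mu_rho. indicator {p..<q} x) = \<rho> q - \<rho> p"
proof -
  have "{p..<q} \<inter> {a..b} = {p..<q}" using assms by auto
  then show ?thesis using measure_mu_rho[OF assms] by simp
qed

lemma integral_indicator_mu_lam:
  assumes "a \<le> p" "p \<le> q" "q \<le> b"
  shows "(LINT x|mu_lam. indicator {p..<q} x) = lam q - lam p"
proof -
  have "{p..<q} \<inter> {a..b} = {p..<q}" using assms by auto
  then show ?thesis using measure_mu_lam[OF assms] by simp
qed

lemma bounded_borel_integrable:
  fixes g :: "real \<Rightarrow> real"
  assumes g: "g \<in> borel_measurable borel" and B: "\<And>x. \<bar>g x\<bar> \<le> B"
  shows "integrable mu_rho g" "integrable mu_lam g" "integrable mu_sum g"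
proof -
  show 1: "integrable mu_rho g"
    using B by (intro finite_measure.integrable_const_bound[OF finite_measure_mu_rho, of _ B] borel_measurable_stieltjes_on[OF g]) auto
  show 2: "integrable mu_lam g"
    using B by (intro finite_measure.integrable_const_bound[OF finite_measure_mu_lam, of _ B] borel_measurable_stieltjes_on[OF g]) auto
  show "integrable mu_sum g"
    using 1 2 regular_\<rho> regular_tv less by (intro integrable_stieltjes_on_sum) auto
qed

lemma elementary_integrand_integrable:
  assumes "elementary_integral X u v g Y"
  shows "integrable mu_rho g" "integrable mu_lam g" "integrable mu_sum g"
  using bounded_borel_integrable[OF elementary_integrand_borel[OF assms]] elementary_integrand_bounded[OF assms]
  by blast+

lemma elementary_integrand_prod_integrable:
  assumes g: "elementary_integral X u v g Y" and g': "elementary_integral X' u' v' g' Y'"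
  shows "integrable mu_rho (\<lambda>x. g x * g' x)" "integrable mu_lam (\<lambda>x. g x * g' x)" "integrable mu_sum (\<lambda>x. g x * g' x)"
proof -
  obtain B B' where B: "\<And>x. \<bar>g x\<bar> \<le> B" "\<And>x. \<bar>g' x\<bar> \<le> B'"
    using elementary_integrand_bounded[OF g] elementary_integrand_bounded[OF g'] by blast
  have "\<bar>g x * g' x\<bar> \<le> B * B'" for x
    unfolding abs_mult using B[of x] by (intro mult_mono) auto
  moreover have "(\<lambda>x. g x * g' x) \<in> borel_measurable borel"
    using elementary_integrand_borel[OF g] elementary_integrand_borel[OF g'] by (rule borel_measurable_times)
  ultimately show "integrable mu_rho (\<lambda>x. g x * g' x)" "integrable mu_lam (\<lambda>x. g x * g' x)" "integrable mu_sum (\<lambda>x. g x * g' x)"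
    using bounded_borel_integrable by blast+
qed

lemma elementary_integral_adapted:
  assumes "elementary_integral X u v g Y" "a \<le> u"
  shows "Y \<in> borel_measurable (\<F> v)"
  using assms(1)
proof induction
  case (increment q)
  then show ?case using X_measurable_filtration[of q v] X_measurable_filtration[of u v] assms(2)
    by auto
qed auto

lemma elementary_integral_measurable:
  assumes "elementary_integral X u v g Y" "a \<le> u" "v \<le> b"
  shows "Y \<in> borel_measurable P"
  using measurable_from_subalg[OF subalgebra_filtration elementary_integral_adapted] assms by blast

lemma elementary_integral_square_integrable:
  assumes "elementary_integral X u v g Y" "a \<le> u" "v \<le> b"
  shows "integrable P (\<lambda>\<omega>. (Y \<omega>)\<^sup>2)"
  using assms(1)
proof induction
  case (increment q)
  then show ?case using assms by (intro increment_moments) auto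
next
  case (add g Y g' Y')
  then show ?case using elementary_integral_measurable assms by (intro integrable_square_add) auto
qed (auto simp: power_mult_distrib)

lemma elementary_integral_integrable:
  assumes "elementary_integral X u v g Y" "a \<le> u" "v \<le> b"
  shows "integrable P Y"
  using square_integrable_imp_integrable[OF elementary_integral_measurable[OF assms]
      elementary_integral_square_integrable[OF assms]] .

lemma expectation_elementary_integral:
  assumes "elementary_integral X u v g Y" "a \<le> u" "v \<le> b"
  shows "expectation Y = (LINT x|mu_lam. g x)"
  using assms(1)
proof induction
  case (increment q)
  then show ?case using assms increment_moments(2)[of u q] integral_indicator_mu_lam[of u q] by simp
next
  case (add g Y g' Y')
  then show ?case
    using elementary_integral_integrable[OF _ assms(2,3)] elementary_integrand_integrable(2) by simp
qed auto

text \<open>For \<open>p \<le> q\<close> write \<open>X q - X a = (X p - X a) + (X q - X p)\<close>; the mixed term is a product of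
  expectations because the second increment is independent of the past of \<open>p\<close>.\<close>

lemma increments_second_moment:
  assumes "a \<le> p" "p \<le> q" "q \<le> b"
  shows "expectation (\<lambda>\<omega>. (X p \<omega> - X a \<omega>) * (X q \<omega> - X a \<omega>))
       = (\<rho> p - \<rho> a) + (lam p - lam a) * (lam q - lam a)"
proof -
  let ?D = "\<lambda>\<omega>. X p \<omega> - X a \<omega>" and ?E = "\<lambda>\<omega>. X q \<omega> - X p \<omega>"
  have [measurable]: "?D \<in> borel_measurable P" "?E \<in> borel_measurable P"
    using assms by (auto intro!: borel_measurable_diff X_measurable)
  have D2: "integrable P (\<lambda>\<omega>. (?D \<omega>)\<^sup>2)" and E2: "integrable P (\<lambda>\<omega>. (?E \<omega>)\<^sup>2)"
    using assms by (auto intro!: increment_moments)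
  have iDE: "integrable P ?D" "integrable P ?E"
    by (rule square_integrable_imp_integrable, measurable, rule D2 E2)+
  have DE: "expectation (\<lambda>\<omega>. ?D \<omega> * ?E \<omega>) = (lam p - lam a) * (lam q - lam p)"
  proof (cases "p = q")
    case False
    have "?D \<in> borel_measurable (\<F> p)"
      using assms by (intro borel_measurable_diff X_measurable_filtration) auto
    then have "indep_var borel ?D borel ?E"
      using assms False by (intro indep_past_increment) auto
    then show ?thesis
      using indep_var_lebesgue_integral[of ?D ?E] iDE increment_moments(2)[of a p] increment_moments(2)[of p q] assms
      by simp
  qed simp
  have "(\<lambda>\<omega>. (X p \<omega> - X a \<omega>) * (X q \<omega> - X a \<omega>)) = (\<lambda>\<omega>. (?D \<omega>)\<^sup>2 + ?D \<omega> * ?E \<omega>)"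
    by (auto simp: power2_eq_square algebra_simps)
  then have "expectation (\<lambda>\<omega>. (X p \<omega> - X a \<omega>) * (X q \<omega> - X a \<omega>)) = expectation (\<lambda>\<omega>. (?D \<omega>)\<^sup>2) + expectation (\<lambda>\<omega>. ?D \<omega> * ?E \<omega>)"
    using D2 integrable_prod_of_squares[OF _ _ D2 E2] by simp
  also have "\<dots> = (\<rho> p - \<rho> a) + (lam p - lam a) * (lam q - lam a)"
    unfolding DE using increment_moments(3)[of a p] assms by (simp add: power2_eq_square algebra_simps)
  finally show ?thesis .
qed

text \<open>This is the isometry of the Wiener integral, with a correction for the means. Both sides are
  bilinear in the pairs, so generators suffice; there
  \<open>1\<^bsub>[a, p)\<^esub> 1\<^bsub>[a, q)\<^esub> = 1\<^bsub>[a, min p q)\<^esub>\<close> matches the second moment of the increments.\<close>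

lemma elementary_integral_inner:
  assumes Y: "elementary_integral X a b g Y" and Y': "elementary_integral X a b g' Y'"
  shows "expectation (\<lambda>\<omega>. Y \<omega> * Y' \<omega>)
       = (LINT x|mu_rho. g x * g' x) + (LINT x|mu_lam. g x) * (LINT x|mu_lam. g' x)"
proof -
  have int: "integrable P (\<lambda>\<omega>. U \<omega> * V \<omega>)"
    if "elementary_integral X a b h U" "elementary_integral X a b k V" for h k U V
    using that elementary_integral_measurable elementary_integral_square_integrable
    by (intro integrable_prod_of_squares) auto
  have base: "expectation (\<lambda>\<omega>. (X p \<omega> - X a \<omega>) * (X q \<omega> - X a \<omega>))
      = (LINT x|mu_rho. indicator {a..<p} x * indicator {a..<q} x)
        + (LINT x|mu_lam. indicator {a..<p} x) * (LINT x|mu_lam. indicator {a..<q} x)"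
    if pq: "a \<le> p" "p \<le> b" "a \<le> q" "q \<le> b" for p q
  proof -
    have "(\<lambda>x. indicator {a..<p} x * indicator {a..<q} x :: real) = indicator {a..<min p q}"
      by (auto simp: indicator_def)
    then have "(LINT x|mu_rho. indicator {a..<p} x * indicator {a..<q} x) = \<rho> (min p q) - \<rho> a"
      using integral_indicator_mu_rho[of a "min p q"] pq by simp
    moreover have "expectation (\<lambda>\<omega>. (X p \<omega> - X a \<omega>) * (X q \<omega> - X a \<omega>))
        = (\<rho> (min p q) - \<rho> a) + (lam p - lam a) * (lam q - lam a)"
      using increments_second_moment[of p q] increments_second_moment[of q p] pq
      by (cases "p \<le> q") (auto simp: min_def mult.commute)
    ultimately show ?thesis using integral_indicator_mu_lam pq by simp
  qed
  have gen: "expectation (\<lambda>\<omega>. (X p \<omega> - X a \<omega>) * Y' \<omega>)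
      = (LINT x|mu_rho. indicator {a..<p} x * g' x) + (LINT x|mu_lam. indicator {a..<p} x) * (LINT x|mu_lam. g' x)"
    if p: "a \<le> p" "p \<le> b" for p
    using Y'
  proof induction
    case (increment q)
    then show ?case using base p by simp
  next
    case (add h U h' U')
    note I = elementary_integral.increment[OF p, of X]
    show ?case
      using add int[OF I add.hyps(1)] int[OF I add.hyps(2)]
        elementary_integrand_prod_integrable(1)[OF I add.hyps(1)] elementary_integrand_prod_integrable(1)[OF I add.hyps(2)]
        elementary_integrand_integrable(2)[OF add.hyps(1)] elementary_integrand_integrable(2)[OF add.hyps(2)]
      by (simp add: distrib_left)
  next
    case (scale h U c)
    then show ?case by (simp add: mult.left_commute distrib_left)
  qed simp
  show ?thesis
    using Y
  proof induction
    case (increment q)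
    then show ?case using gen by simp
  next
    case (add h U h' U')
    show ?case
      using add int[OF add.hyps(1) Y'] int[OF add.hyps(2) Y']
        elementary_integrand_prod_integrable(1)[OF add.hyps(1) Y'] elementary_integrand_prod_integrable(1)[OF add.hyps(2) Y']
        elementary_integrand_integrable(2)[OF add.hyps(1)] elementary_integrand_integrable(2)[OF add.hyps(2)]
      by (simp add: distrib_right)
  next
    case (scale h U c)
    then show ?case by (simp add: mult.assoc distrib_left)
  qed simp
qed

end

section \<open>Limits of integrals of step functions\<close>

context yeh_with_increasing_mean
begin

lemma square_integral_mu_lam_le:
  assumes V: "V \<in> borel_measurable borel" "\<And>x. \<bar>V x\<bar> \<le> B"
  shows "(LINT x|mu_lam. V x)\<^sup>2 \<le> (lam b - lam a) * (LINT x|mu_lam. (V x)\<^sup>2)"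
proof -
  interpret L: finite_measure mu_lam by (rule finite_measure_mu_lam)
  have "(V x)\<^sup>2 \<le> B\<^sup>2" for x
    using V(2)[of x] by (metis abs_le_square_iff abs_of_nonneg abs_ge_zero order_trans)
  then have "integrable mu_lam (\<lambda>x. (V x)\<^sup>2)"
    using V(1) by (intro bounded_borel_integrable(2)[of _ "B\<^sup>2"]) auto
  then have "(LINT x|mu_lam. V x)\<^sup>2 \<le> measure mu_lam {a..b} * (LINT x|mu_lam. (V x)\<^sup>2)"
    using L.square_integral_le[of V] borel_measurable_stieltjes_on[OF V(1)] by simp
  also have "measure mu_lam {a..b} = lam b - lam a"
    using less regular_tv by (subst measure_stieltjes_on_Icc) (auto simp: total_variation_lam)
  finally show ?thesis .
qed

lemma integral_mu_sum:
  fixes h :: "real \<Rightarrow> real"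
  assumes "integrable mu_rho h" "integrable mu_lam h" "\<And>x. 0 \<le> h x"
  shows "(LINT x|mu_sum. h x) = (LINT x|mu_rho. h x) + (LINT x|mu_lam. h x)"
  using assms less regular_\<rho> regular_tv by (intro integral_stieltjes_on_sum) auto

text \<open>The variance of \<open>Y\<close> is the \<open>\<rho>\<close>-part of the squared norm of \<open>g\<close>. Its squared mean is at most
  \<open>\<lambda> b - \<lambda> a\<close> times the \<open>\<lambda>\<close>-part, by the inequality of Cauchy and Schwarz.\<close>

lemma elementary_integral_norm_le:
  assumes Y: "elementary_integral X a b g Y"
  shows "expectation (\<lambda>\<omega>. (Y \<omega>)\<^sup>2) \<le> (1 + (lam b - lam a)) * (LINT x|mu_sum. (g x)\<^sup>2)"
proof -
  obtain B where B: "\<And>x. \<bar>g x\<bar> \<le> B" using elementary_integrand_bounded[OF Y] by blast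
  have pos: "0 \<le> lam b - lam a" using mono_onD[OF mono_lam, of a b] less by simp
  have int: "integrable mu_rho (\<lambda>x. (g x)\<^sup>2)" "integrable mu_lam (\<lambda>x. (g x)\<^sup>2)"
    using elementary_integrand_prod_integrable[OF Y Y] by (simp_all add: power2_eq_square)
  have sum: "(LINT x|mu_sum. (g x)\<^sup>2) = (LINT x|mu_rho. (g x)\<^sup>2) + (LINT x|mu_lam. (g x)\<^sup>2)"
    using int by (intro integral_mu_sum) auto
  have nonneg: "0 \<le> (LINT x|mu_rho. (g x)\<^sup>2)" "0 \<le> (LINT x|mu_lam. (g x)\<^sup>2)"
    by simp_all
  have "expectation (\<lambda>\<omega>. (Y \<omega>)\<^sup>2) = (LINT x|mu_rho. (g x)\<^sup>2) + (LINT x|mu_lam. g x)\<^sup>2"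
    using elementary_integral_inner[OF Y Y] by (simp add: power2_eq_square)
  also have "\<dots> \<le> (LINT x|mu_rho. (g x)\<^sup>2) + (lam b - lam a) * (LINT x|mu_lam. (g x)\<^sup>2)"
    using square_integral_mu_lam_le[OF elementary_integrand_borel[OF Y] B] by simp
  also have "\<dots> \<le> (1 + (lam b - lam a)) * (LINT x|mu_sum. (g x)\<^sup>2)"
  proof -
    let ?R = "LINT x|mu_rho. (g x)\<^sup>2" and ?L = "LINT x|mu_lam. (g x)\<^sup>2"
    have "(1 + (lam b - lam a)) * (?R + ?L) = ?R + (lam b - lam a) * ?L + (?L + (lam b - lam a) * ?R)"
      by (simp add: algebra_simps)
    then show ?thesis
      using nonneg mult_nonneg_nonneg[OF pos nonneg(1)] unfolding sum by linarith
  qed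
  finally show ?thesis .
qed

definition square_integrable :: "(real \<Rightarrow> real) \<Rightarrow> bool" where
  "square_integrable h \<longleftrightarrow> h \<in> borel_measurable mu_sum \<and> integrable mu_sum (\<lambda>x. (h x)\<^sup>2)"

lemma square_integrable_L2_space:
  assumes "f \<in> L2_space a b lam \<rho>"
  shows "square_integrable f"
  using assms less regular_\<rho> regular_tv unfolding square_integrable_def L2_space_def
  by (auto intro!: borel_measurable_stieltjes_on_sum integrable_stieltjes_on_sum)

lemma square_integrable_restrict:
  assumes "square_integrable h" "A \<in> sets borel"
  shows "square_integrable (\<lambda>x. h x * indicator A x)"
proof -
  have A: "(indicator A :: real \<Rightarrow> real) \<in> borel_measurable mu_sum"
    using assms(2) by (intro borel_measurable_stieltjes_on) simp
  have h: "h \<in> borel_measurable mu_sum" and h2: "integrable mu_sum (\<lambda>x. (h x)\<^sup>2)"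
    using assms(1) by (auto simp: square_integrable_def)
  have "integrable mu_sum (\<lambda>x. (h x * indicator A x)\<^sup>2)"
    by (rule Bochner_Integration.integrable_bound[OF h2 borel_measurable_power[OF borel_measurable_times[OF h A]]])
       (auto simp: indicator_def)
  then show ?thesis using h A by (simp add: square_integrable_def)
qed

lemma square_integrable_elementary:
  assumes "elementary_integral X u v g Y"
  shows "square_integrable g"
  using borel_measurable_stieltjes_on[OF elementary_integrand_borel[OF assms]]
    elementary_integrand_prod_integrable(3)[OF assms assms]
  by (simp add: square_integrable_def power2_eq_square)

lemma square_integrable_diff:
  assumes "square_integrable g" "square_integrable h"
  shows "integrable mu_sum (\<lambda>x. (g x - h x)\<^sup>2)"
    and "(LINT x|mu_sum. (g x - h x)\<^sup>2) \<le> 2 * (LINT x|mu_sum. (g x)\<^sup>2) + 2 * (LINT x|mu_sum. (h x)\<^sup>2)"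
    and "square_integrable (\<lambda>x. g x - h x)"
  using assms integrable_square_diff[of g mu_sum h] by (auto simp: square_integrable_def)

lemma wiener_integral_approximation:
  assumes h: "square_integrable h" and Z: "has_wiener_integral P X a b lam \<rho> h Z"
  obtains g Y where "\<And>k. elementary_integral X a b (g k) (Y k)"
    and "(\<lambda>k. LINT x|mu_sum. (g k x - h x)\<^sup>2) \<longlonglongrightarrow> 0"
    and "(\<lambda>k. expectation (\<lambda>\<omega>. (Y k \<omega> - Z \<omega>)\<^sup>2)) \<longlonglongrightarrow> 0"
proof -
  obtain n t c where part: "\<And>k. is_partition a b (n k) (t k)"
    and dist: "(\<lambda>k. L2_dist a b lam \<rho> (step_fun (n k) (t k) (c k)) h) \<longlonglongrightarrow> 0"
    and lim: "(\<lambda>k. LINT \<omega>|P. (step_integral X (n k) (t k) (c k) \<omega> - Z \<omega>)\<^sup>2) \<longlonglongrightarrow> 0"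
    using Z unfolding has_wiener_integral_def by blast
  have "(L2_dist a b lam \<rho> g h)\<^sup>2 = (LINT x|mu_sum. (g x - h x)\<^sup>2)" for g
    unfolding L2_dist_def L2_inner_def by (simp flip: power2_eq_square)
  then have "(\<lambda>k. LINT x|mu_sum. (step_fun (n k) (t k) (c k) x - h x)\<^sup>2) \<longlonglongrightarrow> 0"
    using tendsto_power[OF dist, of 2] by simp
  from that[of "\<lambda>k. step_fun (n k) (t k) (c k)", OF elementary_integral_step_fun[OF part] this lim]
  show thesis .
qed

text \<open>The Wiener integral does not depend on the approximating sequence: if \<open>g k\<close> and \<open>g' k\<close> both converge
  to \<open>h\<close>, the norm bound applied to \<open>g k - g' k\<close> shows that the integrals share their limit.\<close>

lemma elementary_integral_tendsto:
  assumes h: "square_integrable h" and Z: "has_wiener_integral P X a b lam \<rho> h Z"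
    and Y: "\<And>k. elementary_integral X a b (g k) (Y k)"
    and g: "(\<lambda>k. LINT x|mu_sum. (g k x - h x)\<^sup>2) \<longlonglongrightarrow> 0"
  shows "(\<lambda>k. expectation (\<lambda>\<omega>. (Y k \<omega> - Z \<omega>)\<^sup>2)) \<longlonglongrightarrow> 0"
proof -
  obtain g' Y' where Y': "\<And>k. elementary_integral X a b (g' k) (Y' k)"
    and g': "(\<lambda>k. LINT x|mu_sum. (g' k x - h x)\<^sup>2) \<longlonglongrightarrow> 0"
    and lim: "(\<lambda>k. expectation (\<lambda>\<omega>. (Y' k \<omega> - Z \<omega>)\<^sup>2)) \<longlonglongrightarrow> 0"
    using wiener_integral_approximation[OF h Z] by blast
  have meas [measurable]: "Y k \<in> borel_measurable P" "Y' k \<in> borel_measurable P" "Z \<in> borel_measurable P" for k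
    using elementary_integral_measurable[OF Y] elementary_integral_measurable[OF Y'] Z
    by (auto simp: has_wiener_integral_def)
  have Z2: "integrable P (\<lambda>\<omega>. (Z \<omega>)\<^sup>2)" using Z by (simp add: has_wiener_integral_def)
  have Y2: "integrable P (\<lambda>\<omega>. (Y k \<omega>)\<^sup>2)" "integrable P (\<lambda>\<omega>. (Y' k \<omega>)\<^sup>2)" for k
    using elementary_integral_square_integrable[OF Y] elementary_integral_square_integrable[OF Y'] by auto
  let ?C = "1 + (lam b - lam a)"
  have C: "0 \<le> ?C" using mono_onD[OF mono_lam, of a b] less by simp
  let ?bound = "\<lambda>k. 2 * (?C * (2 * (LINT x|mu_sum. (g k x - h x)\<^sup>2) + 2 * (LINT x|mu_sum. (g' k x - h x)\<^sup>2)))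
      + 2 * expectation (\<lambda>\<omega>. (Y' k \<omega> - Z \<omega>)\<^sup>2)"
  have bound: "expectation (\<lambda>\<omega>. (Y k \<omega> - Z \<omega>)\<^sup>2) \<le> ?bound k" for k
  proof -
    have "(LINT x|mu_sum. (g k x - g' k x)\<^sup>2)
        \<le> 2 * (LINT x|mu_sum. (g k x - h x)\<^sup>2) + 2 * (LINT x|mu_sum. (g' k x - h x)\<^sup>2)"
      using square_integrable_diff(2)[OF square_integrable_diff(3)[OF square_integrable_elementary[OF Y] h, of k]
          square_integrable_diff(3)[OF square_integrable_elementary[OF Y'] h, of k]] by simp
    then have "?C * (LINT x|mu_sum. (g k x - g' k x)\<^sup>2)
        \<le> ?C * (2 * (LINT x|mu_sum. (g k x - h x)\<^sup>2) + 2 * (LINT x|mu_sum. (g' k x - h x)\<^sup>2))"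
      using C by (rule mult_left_mono)
    moreover have "expectation (\<lambda>\<omega>. (Y k \<omega> - Y' k \<omega>)\<^sup>2) \<le> ?C * (LINT x|mu_sum. (g k x - g' k x)\<^sup>2)"
      using elementary_integral_norm_le[OF elementary_integral_diff[OF Y Y', of k k]] by simp
    moreover have "expectation (\<lambda>\<omega>. (Y k \<omega> - Z \<omega>)\<^sup>2)
        \<le> 2 * expectation (\<lambda>\<omega>. (Y k \<omega> - Y' k \<omega>)\<^sup>2) + 2 * expectation (\<lambda>\<omega>. (Y' k \<omega> - Z \<omega>)\<^sup>2)"
      using integrable_square_add(2)[OF _ _ integrable_square_diff(1)[OF _ _ Y2(1) Y2(2)] integrable_square_diff(1)[OF _ _ Y2(2) Z2], of k k k]
      by simp
    ultimately show ?thesis by linarith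
  qed
  have "?bound \<longlonglongrightarrow> 2 * (?C * (2 * 0 + 2 * 0)) + 2 * 0"
    by (intro tendsto_intros g g' lim)
  then have lim_bound: "?bound \<longlonglongrightarrow> 0" by simp
  show ?thesis
    by (rule tendsto_sandwich[OF _ _ tendsto_const lim_bound]) (use bound in auto)
qed

lemma square_integral_restrict_le:
  assumes "square_integrable g" "A \<in> sets borel"
  shows "(LINT x|mu_sum. (g x * indicator A x)\<^sup>2) \<le> (LINT x|mu_sum. (g x)\<^sup>2)"
  using square_integrable_restrict[OF assms] assms(1) unfolding square_integrable_def
  by (intro integral_mono) (auto simp: indicator_def)

text \<open>For a single increment this is its independence of the past, and both sides are linear in \<open>Y\<close>.\<close>

lemma elementary_integral_past_factor:
  assumes "elementary_integral X s b g Y" and s: "a \<le> s" "s \<le> b" and A: "A \<in> sets (\<F> s)"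
  shows "expectation (\<lambda>\<omega>. indicator A \<omega> * Y \<omega>) = prob A * expectation Y"
proof -
  have AP: "A \<in> events" using A subalgebra_filtration[OF s(2)] by (auto simp: subalgebra_def)
  have int: "integrable P (\<lambda>\<omega>. indicator A \<omega> * U \<omega>)" if "elementary_integral X s b h U" for h U
    using integrable_mult_indicator[OF AP elementary_integral_integrable[OF that]] s by simp
  show ?thesis
    using assms(1)
  proof induction
    case (increment q)
    show ?case
    proof (cases "q = s")
      case False
      have "(indicator A :: _ \<Rightarrow> real) \<in> borel_measurable (\<F> s)"
        using A by simp
      then have "indep_var borel (indicator A :: _ \<Rightarrow> real) borel (\<lambda>\<omega>. X q \<omega> - X s \<omega>)"
        using increment s False by (intro indep_past_increment) auto
      moreover have "integrable P (\<lambda>\<omega>. X q \<omega> - X s \<omega>)"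
        using elementary_integral_integrable[OF elementary_integral.increment[OF increment, of X]] s by simp
      moreover have "integrable P (indicator A :: _ \<Rightarrow> real)"
        using AP by (simp add: integrable_indicator_iff less_top[symmetric])
      moreover have "expectation (indicator A) = prob A"
        using AP sets.sets_into_space[OF AP] by (simp add: Int_absorb2)
      ultimately show ?thesis
        using indep_var_lebesgue_integral by metis
    qed simp
  next
    case (add h U h' U')
    then show ?case
      using int[OF add.hyps(1)] int[OF add.hyps(2)] elementary_integral_integrable[OF add.hyps(1)]
        elementary_integral_integrable[OF add.hyps(2)] s
      by (simp add: distrib_left)
  next
    case (scale h U c)
    then show ?case by (simp add: mult.left_commute)
  qed simp
qed

text \<open>The step functions \<open>g k\<close> may take negative values, but on \<open>[a, b]\<close>, where \<open>h \<ge> 0\<close>, the negative part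
  \<open>V\<close> of \<open>g k\<close> satisfies \<open>V \<le> \<bar>g k - h\<bar>\<close>. Hence the integral of \<open>V\<close> with respect to \<open>\<lambda>\<close> tends to \<open>0\<close>,
  and it bounds the integral of \<open>g k\<close> from below.\<close>

lemma integral_mu_lam_limit_nonneg:
  assumes h: "square_integrable h" and nonneg: "\<And>x. x \<in> {a..b} \<Longrightarrow> 0 \<le> h x"
    and g: "\<And>k. elementary_integral X a b (g k) (Y k)"
    and lim: "(\<lambda>k. LINT x|mu_sum. (g k x - h x)\<^sup>2) \<longlonglongrightarrow> 0"
    and A: "A \<in> sets borel"
    and c: "(\<lambda>k. LINT x|mu_lam. g k x * indicator A x) \<longlonglongrightarrow> c"
  shows "0 \<le> c"
proof -
  let ?\<Lambda> = "lam b - lam a"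
  have \<Lambda>: "0 \<le> ?\<Lambda>" using mono_onD[OF mono_lam, of a b] less by simp
  have bound: "- sqrt (?\<Lambda> * (LINT x|mu_sum. (g k x - h x)\<^sup>2)) \<le> (LINT x|mu_lam. g k x * indicator A x)" for k
  proof -
    define V where "V = (\<lambda>x. max 0 (- g k x))"
    have gb: "g k \<in> borel_measurable borel" using elementary_integrand_borel[OF g] .
    obtain B where B: "\<And>x. \<bar>g k x\<bar> \<le> B" using elementary_integrand_bounded[OF g] by blast
    have VB: "\<bar>V x\<bar> \<le> B" for x
      using B[of x] unfolding V_def by linarith
    have Vb: "V \<in> borel_measurable borel" unfolding V_def using gb by measurable
    have "(V x)\<^sup>2 \<le> B\<^sup>2" for x
      using VB[of x] by (metis abs_le_square_iff abs_of_nonneg abs_ge_zero order_trans)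
    then have "\<bar>(V x)\<^sup>2\<bar> \<le> B\<^sup>2" for x by simp
    note V2 = bounded_borel_integrable[OF borel_measurable_power[OF Vb] this]
    have gA: "\<bar>g k x * indicator A x\<bar> \<le> B" for x
      using B[of x] by (auto simp: indicator_def)
    have gAi: "integrable mu_lam (\<lambda>x. g k x * indicator A x)"
      using gb A gA by (intro bounded_borel_integrable(2)[of _ B]) auto
    have "(LINT x|mu_lam. (V x)\<^sup>2) \<le> (LINT x|mu_sum. (V x)\<^sup>2)"
      using integral_mu_sum[OF V2(1,2)] by simp
    also have "\<dots> \<le> (LINT x|mu_sum. (g k x - h x)\<^sup>2)"
    proof (rule integral_mono[OF V2(3) square_integrable_diff(1)[OF square_integrable_elementary[OF g] h]])
      fix x assume "x \<in> space mu_sum"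
      then have "0 \<le> h x" using nonneg by simp
      then show "(V x)\<^sup>2 \<le> (g k x - h x)\<^sup>2"
        by (auto simp: V_def max_def abs_le_square_iff[symmetric])
    qed
    finally have "(LINT x|mu_lam. V x)\<^sup>2 \<le> ?\<Lambda> * (LINT x|mu_sum. (g k x - h x)\<^sup>2)"
      using square_integral_mu_lam_le[OF Vb VB] \<Lambda> by (meson mult_left_mono order_trans)
    then have "(LINT x|mu_lam. V x) \<le> sqrt (?\<Lambda> * (LINT x|mu_sum. (g k x - h x)\<^sup>2))"
      by (rule real_le_rsqrt)
    moreover have "(LINT x|mu_lam. - V x) \<le> (LINT x|mu_lam. g k x * indicator A x)"
      using bounded_borel_integrable(2)[OF Vb VB] gAi
      by (intro integral_mono) (auto simp: V_def indicator_def)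
    ultimately show ?thesis by simp
  qed
  have "(\<lambda>k. - sqrt (?\<Lambda> * (LINT x|mu_sum. (g k x - h x)\<^sup>2))) \<longlonglongrightarrow> - sqrt (?\<Lambda> * 0)"
    by (intro tendsto_intros lim)
  then show ?thesis
    using c bound by (intro LIMSEQ_le[of "\<lambda>k. - sqrt (?\<Lambda> * (LINT x|mu_sum. (g k x - h x)\<^sup>2))" 0]) auto
qed

end

section \<open>The submartingale property\<close>

context yeh_with_increasing_mean
begin

context
  fixes f :: "real \<Rightarrow> real" and M :: "real \<Rightarrow> 'w \<Rightarrow> real"
  assumes f: "square_integrable f"
    and f_nonneg: "\<And>x. x \<in> {a..b} \<Longrightarrow> 0 \<le> f x"
    and M: "\<And>t. t \<in> {a..b} \<Longrightarrow> has_wiener_integral_upto P X a b lam \<rho> f t (M t)"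
begin

lemma integral_process_measurable:
  assumes "t \<in> {a..b}"
  shows "M t \<in> borel_measurable P" "integrable P (\<lambda>\<omega>. (M t \<omega>)\<^sup>2)" "integrable P (M t)"
proof -
  show 1: "M t \<in> borel_measurable P" "integrable P (\<lambda>\<omega>. (M t \<omega>)\<^sup>2)"
    using M[OF assms] by (auto simp: has_wiener_integral_upto_def has_wiener_integral_def)
  show "integrable P (M t)" using square_integrable_imp_integrable[OF 1] .
qed

text \<open>One sequence of step functions serves for both times: if \<open>g k\<close> converges to \<open>f 1\<^bsub>[a, t)\<^esub>\<close>, then
  \<open>g k 1\<^bsub>[a, s)\<^esub>\<close> converges to \<open>f 1\<^bsub>[a, s)\<^esub>\<close>. So the part \<open>Y1 k\<close> of the integral before \<open>s\<close> converges
  to \<open>M s\<close>, while the whole converges to \<open>M t\<close>.\<close>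

lemma integral_process_approximation:
  assumes st: "s \<in> {a..b}" "t \<in> {a..b}" "s \<le> t"
  obtains g Y1 Y2 where "\<And>k. elementary_integral X a b (g k) (\<lambda>\<omega>. Y1 k \<omega> + Y2 k \<omega>)"
    and "(\<lambda>k. LINT x|mu_sum. (g k x - f x * indicator {a..<t} x)\<^sup>2) \<longlonglongrightarrow> 0"
    and "\<And>k. elementary_integral X a s (\<lambda>x. g k x * indicator {a..<s} x) (Y1 k)"
    and "\<And>k. elementary_integral X s b (\<lambda>x. g k x * indicator {s..<b} x) (Y2 k)"
    and "(\<lambda>k. expectation (\<lambda>\<omega>. (Y1 k \<omega> - M s \<omega>)\<^sup>2)) \<longlonglongrightarrow> 0"
    and "(\<lambda>k. expectation (\<lambda>\<omega>. (Y1 k \<omega> + Y2 k \<omega> - M t \<omega>)\<^sup>2)) \<longlonglongrightarrow> 0"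
proof -
  let ?f = "\<lambda>r x. f x * indicator {a..<r} x"
  have sq: "square_integrable (?f r)" for r using f by (rule square_integrable_restrict) simp
  have W: "has_wiener_integral P X a b lam \<rho> (?f r) (M r)" if "r \<in> {a..b}" for r
    using M[OF that] by (simp add: has_wiener_integral_upto_def)
  obtain g Y where Y: "\<And>k. elementary_integral X a b (g k) (Y k)"
    and g: "(\<lambda>k. LINT x|mu_sum. (g k x - ?f t x)\<^sup>2) \<longlonglongrightarrow> 0"
    and limY: "(\<lambda>k. expectation (\<lambda>\<omega>. (Y k \<omega> - M t \<omega>)\<^sup>2)) \<longlonglongrightarrow> 0"
    using wiener_integral_approximation[OF sq W[OF st(2)]] by blast
  let ?split = "\<lambda>k Y1 Y2. elementary_integral X a s (\<lambda>x. g k x * indicator {a..<s} x) Y1 \<and>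
      elementary_integral X s b (\<lambda>x. g k x * indicator {s..<b} x) Y2 \<and> Y k = (\<lambda>\<omega>. Y1 \<omega> + Y2 \<omega>)"
  have "\<forall>k. \<exists>Y1 Y2. ?split k Y1 Y2"
    using st by (intro allI elementary_integral_split[OF Y]) simp_all
  from choice[OF this] obtain Y1 where "\<forall>k. \<exists>Y2. ?split k (Y1 k) Y2" ..
  from choice[OF this] obtain Y2 where split: "\<forall>k. ?split k (Y1 k) (Y2 k)" ..
  have Y1: "elementary_integral X a s (\<lambda>x. g k x * indicator {a..<s} x) (Y1 k)"
    and Y2: "elementary_integral X s b (\<lambda>x. g k x * indicator {s..<b} x) (Y2 k)"
    and sum: "Y k = (\<lambda>\<omega>. Y1 k \<omega> + Y2 k \<omega>)" for k
    using split by simp_all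
  have "(\<lambda>k. LINT x|mu_sum. (g k x * indicator {a..<s} x - ?f s x)\<^sup>2) \<longlonglongrightarrow> 0"
  proof (rule tendsto_sandwich[OF _ _ tendsto_const g])
    have "(LINT x|mu_sum. (g k x * indicator {a..<s} x - ?f s x)\<^sup>2) \<le> (LINT x|mu_sum. (g k x - ?f t x)\<^sup>2)" for k
    proof -
      have "(\<lambda>x. (g k x - ?f t x) * indicator {a..<s} x) = (\<lambda>x. g k x * indicator {a..<s} x - ?f s x)"
        using st by (auto simp: fun_eq_iff indicator_def)
      then show ?thesis
        using square_integral_restrict_le[OF square_integrable_diff(3)[OF square_integrable_elementary[OF Y] sq[of t]], of "{a..<s}" k]
        by (simp add: fun_eq_iff)
    qed
    then show "\<forall>\<^sub>F k in sequentially. (LINT x|mu_sum. (g k x * indicator {a..<s} x - ?f s x)\<^sup>2) \<le> (LINT x|mu_sum. (g k x - ?f t x)\<^sup>2)"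
      by simp
  qed simp
  then have lim1: "(\<lambda>k. expectation (\<lambda>\<omega>. (Y1 k \<omega> - M s \<omega>)\<^sup>2)) \<longlonglongrightarrow> 0"
    using elementary_integral_mono[OF Y1, of a b] st
    by (intro elementary_integral_tendsto[OF sq W[OF st(1)]]) auto
  show thesis
    using that[of g Y1 Y2, OF Y[unfolded sum] g Y1 Y2 lim1 limY[unfolded sum]] .
qed

lemma integral_process_adapted:
  assumes t: "t \<in> {a..b}"
  shows "AE \<omega> in P. M t \<omega> = real_cond_exp P (\<F> t) (M t) \<omega>"
proof -
  obtain g Y1 Y2 where "\<And>k. elementary_integral X a b (g k) (\<lambda>\<omega>. Y1 k \<omega> + Y2 k \<omega>)"
    and "(\<lambda>k. LINT x|mu_sum. (g k x - f x * indicator {a..<t} x)\<^sup>2) \<longlonglongrightarrow> 0"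
    and Y1: "\<And>k. elementary_integral X a t (\<lambda>x. g k x * indicator {a..<t} x) (Y1 k)"
    and "\<And>k. elementary_integral X t b (\<lambda>x. g k x * indicator {t..<b} x) (Y2 k)"
    and lim: "(\<lambda>k. expectation (\<lambda>\<omega>. (Y1 k \<omega> - M t \<omega>)\<^sup>2)) \<longlonglongrightarrow> 0"
    and "(\<lambda>k. expectation (\<lambda>\<omega>. (Y1 k \<omega> + Y2 k \<omega> - M t \<omega>)\<^sup>2)) \<longlonglongrightarrow> 0"
  proof (rule integral_process_approximation[OF t t order_refl], goal_cases)
    case 1
    show ?case by (rule 1(1)[OF 1(2-7)])
  qed
  have "t \<le> b" using t by simp
  then show ?thesis
    using L2_limit_measurable_version[OF subalgebra_filtration integral_process_measurable(1,2)[OF t]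
        elementary_integral_adapted[OF Y1] elementary_integral_square_integrable[OF Y1] lim] by blast
qed

text \<open>The part \<open>Y2 k\<close> of the approximating integrals after \<open>s\<close> has expectation \<open>\<integral> g k 1\<^bsub>[s, b)\<^esub> d\<lambda>\<close>, also
  conditionally on the past. Passing to the limit over each past event yields the conditional
  expectation of \<open>M t - M s\<close>: the constant \<open>c\<close>, the limit of these means.\<close>

lemma integral_process_cond_exp:
  assumes st: "s \<in> {a..b}" "t \<in> {a..b}" "s \<le> t"
  shows "\<exists>c\<ge>0. AE \<omega> in P. real_cond_exp P (\<F> s) (M t) \<omega> = M s \<omega> + c"
proof -
  obtain g Y1 Y2 where Y: "\<And>k. elementary_integral X a b (g k) (\<lambda>\<omega>. Y1 k \<omega> + Y2 k \<omega>)"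
    and g: "(\<lambda>k. LINT x|mu_sum. (g k x - f x * indicator {a..<t} x)\<^sup>2) \<longlonglongrightarrow> 0"
    and Y1: "\<And>k. elementary_integral X a s (\<lambda>x. g k x * indicator {a..<s} x) (Y1 k)"
    and Y2: "\<And>k. elementary_integral X s b (\<lambda>x. g k x * indicator {s..<b} x) (Y2 k)"
    and lim1: "(\<lambda>k. expectation (\<lambda>\<omega>. (Y1 k \<omega> - M s \<omega>)\<^sup>2)) \<longlonglongrightarrow> 0"
    and lim: "(\<lambda>k. expectation (\<lambda>\<omega>. (Y1 k \<omega> + Y2 k \<omega> - M t \<omega>)\<^sup>2)) \<longlonglongrightarrow> 0"
  proof (rule integral_process_approximation[OF st], goal_cases)
    case 1
    show ?case by (rule 1(1)[OF 1(2-7)])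
  qed
  note Mt = integral_process_measurable[OF st(2)] and Ms = integral_process_measurable[OF st(1)]
  have sub: "subalgebra P (\<F> s)" using st by (intro subalgebra_filtration) simp
  interpret F: finite_measure_subalgebra P "\<F> s" using sub by unfold_locales
  have Y1m: "Y1 k \<in> borel_measurable P" and Y12: "integrable P (\<lambda>\<omega>. (Y1 k \<omega>)\<^sup>2)" and Y1i: "integrable P (Y1 k)" for k
    using elementary_integral_measurable[OF Y1] elementary_integral_square_integrable[OF Y1] elementary_integral_integrable[OF Y1] st by auto
  have Y2i: "integrable P (Y2 k)" for k
    using elementary_integral_integrable[OF Y2] st by auto
  have Ym: "(\<lambda>\<omega>. Y1 k \<omega> + Y2 k \<omega>) \<in> borel_measurable P" and YY: "integrable P (\<lambda>\<omega>. (Y1 k \<omega> + Y2 k \<omega>)\<^sup>2)" for k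
    using elementary_integral_measurable[OF Y] elementary_integral_square_integrable[OF Y] by auto
  define c where "c = expectation (M t) - expectation (M s)"
  have lim_set: "(\<lambda>k. prob A * expectation (Y2 k)) \<longlonglongrightarrow>
      expectation (\<lambda>\<omega>. indicator A \<omega> * M t \<omega>) - expectation (\<lambda>\<omega>. indicator A \<omega> * M s \<omega>)"
    if A: "A \<in> sets (\<F> s)" for A
  proof -
    have AP: "A \<in> events" using A sub by (auto simp: subalgebra_def)
    have int: "integrable P (\<lambda>\<omega>. indicator A \<omega> * U \<omega>)" if "integrable P U" for U :: "'w \<Rightarrow> real"
      using integrable_mult_indicator[OF AP that] by simp
    have "expectation (\<lambda>\<omega>. indicator A \<omega> * (Y1 k \<omega> + Y2 k \<omega>)) - expectation (\<lambda>\<omega>. indicator A \<omega> * Y1 k \<omega>) = prob A * expectation (Y2 k)" for k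
      using elementary_integral_past_factor[OF Y2 _ _ A, of k] int[OF Y1i, of k] int[OF Y2i, of k] st
      by (simp add: distrib_left)
    moreover have "(\<lambda>k. expectation (\<lambda>\<omega>. indicator A \<omega> * (Y1 k \<omega> + Y2 k \<omega>)) - expectation (\<lambda>\<omega>. indicator A \<omega> * Y1 k \<omega>))
        \<longlonglongrightarrow> expectation (\<lambda>\<omega>. indicator A \<omega> * M t \<omega>) - expectation (\<lambda>\<omega>. indicator A \<omega> * M s \<omega>)"
      by (intro tendsto_diff set_integral_tendsto_of_L2[OF AP Mt(1,2) Ym YY lim] set_integral_tendsto_of_L2[OF AP Ms(1,2) Y1m Y12 lim1])
    ultimately show ?thesis by simp
  qed
  have top: "space P \<in> sets (\<F> s)" using sets.top[of "\<F> s"] by simp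
  have "expectation (\<lambda>\<omega>. indicator (space P) \<omega> * U \<omega>) = expectation U" for U :: "'w \<Rightarrow> real"
    by (intro Bochner_Integration.integral_cong) auto
  then have limE: "(\<lambda>k. expectation (Y2 k)) \<longlonglongrightarrow> c"
    using lim_set[OF top] by (simp add: prob_space c_def)
  have "0 \<le> c"
  proof (rule integral_mu_lam_limit_nonneg[OF _ _ Y g])
    show "square_integrable (\<lambda>x. f x * indicator {a..<t} x)" using f by (rule square_integrable_restrict) simp
    show "(\<lambda>k. LINT x|mu_lam. g k x * indicator {s..<b} x) \<longlonglongrightarrow> c"
      using limE expectation_elementary_integral[OF Y2] st by simp
  qed (use f_nonneg in auto)
  have indA: "expectation (\<lambda>\<omega>. indicator A \<omega> * M t \<omega>) = expectation (\<lambda>\<omega>. indicator A \<omega> * M s \<omega>) + prob A * c"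
    if "A \<in> sets (\<F> s)" for A
    using LIMSEQ_unique[OF lim_set[OF that] tendsto_mult_left[OF limE]] by simp
  \<comment> \<open>\<open>M s\<close> itself need not be measurable at time \<open>s\<close>, so its measurable version takes its place.\<close>
  let ?Z = "real_cond_exp P (\<F> s) (M s)"
  have Zi: "integrable P ?Z" using F.real_cond_exp_int(1)[OF Ms(3)] .
  have "AE \<omega> in P. real_cond_exp P (\<F> s) (M t) \<omega> = ?Z \<omega> + c"
  proof (rule F.real_cond_exp_charact)
    fix A assume A: "A \<in> sets (\<F> s)"
    then have AP: "A \<in> events" using sub by (auto simp: subalgebra_def)
    have iZ: "integrable P (\<lambda>\<omega>. indicator A \<omega> * ?Z \<omega>)"
      using integrable_mult_indicator[OF AP Zi] by simp
    have "(LINT \<omega>:A|P. ?Z \<omega> + c) = expectation (\<lambda>\<omega>. indicator A \<omega> * ?Z \<omega>) + expectation (\<lambda>\<omega>. indicator A \<omega> * c)"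
      unfolding set_lebesgue_integral_def using iZ AP
      by (simp add: distrib_left integrable_indicator_iff less_top[symmetric])
    also have "expectation (\<lambda>\<omega>. indicator A \<omega> * ?Z \<omega>) = expectation (\<lambda>\<omega>. indicator A \<omega> * M s \<omega>)"
      using F.real_cond_exp_intA[OF Ms(3) A] by (simp add: set_lebesgue_integral_def)
    also have "expectation (\<lambda>\<omega>. indicator A \<omega> * c) = prob A * c"
      using sets.sets_into_space[OF AP] by (simp add: Int_absorb2)
    finally show "(LINT \<omega>:A|P. M t \<omega>) = (LINT \<omega>:A|P. ?Z \<omega> + c)"
      using indA[OF A] by (simp add: set_lebesgue_integral_def)
  qed (use Mt Zi in auto)
  with integral_process_adapted[OF st(1)] have "AE \<omega> in P. real_cond_exp P (\<F> s) (M t) \<omega> = M s \<omega> + c"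
    by eventually_elim simp
  with \<open>0 \<le> c\<close> show ?thesis by blast
qed

lemma submartingale_integral_process: "submartingale_on P a b \<F> M"
  unfolding submartingale_on_def
proof (intro conjI ballI impI)
  fix t assume t: "t \<in> {a..b}"
  then show "subalgebra P (\<F> t)" by (intro subalgebra_filtration) simp
  show "integrable P (M t)" using integral_process_measurable[OF t] by simp
  show "\<exists>Z\<in>borel_measurable (\<F> t). AE \<omega> in P. M t \<omega> = Z \<omega>"
    using integral_process_adapted[OF t] by (intro bexI[of _ "real_cond_exp P (\<F> t) (M t)"]) auto
next
  fix s t assume st: "s \<in> {a..b}" "t \<in> {a..b}" "s \<le> t"
  then show "sets (\<F> s) \<subseteq> sets (\<F> t)" by (intro sets_filtration_mono)
  obtain c where "0 \<le> c" "AE \<omega> in P. real_cond_exp P (\<F> s) (M t) \<omega> = M s \<omega> + c"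
    using integral_process_cond_exp[OF st] by blast
  then show "AE \<omega> in P. M s \<omega> \<le> real_cond_exp P (\<F> s) (M t) \<omega>" by auto
qed

end

end

theorem theorem3p1:
  fixes P :: "'w measure"
    and X M :: "real \<Rightarrow> 'w \<Rightarrow> real"
    and a b :: real
    and lam \<rho> f :: "real \<Rightarrow> real"
  assumes "0 \<le> a" and "a < b"
    and "yeh_parameters a b lam \<rho>"
    and "yeh_process P a b lam \<rho> X"
    and "mono_on {a..b} lam"
    and "f \<in> L2_space a b lam \<rho>"
    and "\<forall>s\<in>{a..b}. 0 \<le> f s"
    and "\<forall>t\<in>{a..b}. has_wiener_integral_upto P X a b lam \<rho> f t (M t)"
  shows "submartingale_on P a b (natural_filtration P a X) M"
proof -
  interpret prob_space P
    using \<open>yeh_process P a b lam \<rho> X\<close> by (simp add: yeh_process_def)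
  interpret yeh_with_increasing_mean P X a b lam \<rho>
    using assms by unfold_locales
  show ?thesis
    using assms by (intro submartingale_integral_process[of f] square_integrable_L2_space) auto
qed

end
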